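(* Let $q$ be a prime power, let $k\ge 1$ be an integer, put $n=(q^k-1)/(q-1)$, and let $H$ be a $k\times n$ parity check matrix over $\mathbb{F}_q$ of a $q$-ary cyclic Hamming code of length $n$, where $\gcd(n,q-1)=1$. For $i\ge 1$ let $H_i$ be the matrix obtained from $H$ by cyclically shifting its columns $i$ times to the right. Let $c$ be an integer with $1\le c\le n-1$ and let $C\subseteq\mathbb{F}_q^{(c+3)n}$ be the linear code with parity check matrix $$H^{(c)}=\begin{bmatrix} H & 0 & H & H & \cdots & H\\ 0 & H & H & H_1 & \cdots & H_c\end{bmatrix},$$ where $0$ is the $k\times n$ zero matrix. Then: (i) If $q=2$ and $c=n-1$, then $C$ is a binary Hamming code of length $2^{2k}-1$. (ii) If $q>2$ or $c<n-1$, then $C$ is a linear completely regular $[(c+3)n,\,(c+3)n-2k,\,3;\,2]_q$ code with intersection array $$\{(c+3)n(q-1),\ (c+2)\left((q-1)n-1-c\right);\ 1,\ (c+2)(c+3)\}.$$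
   Context: A $q$-ary Hamming code of length $n=(q^k-1)/(q-1)$ is a linear code with a $k\times n$ parity check matrix whose columns are representatives of the $n$ one-dimensional subspaces of $\mathbb{F}_q^k$, one for each; it is cyclic if it is invariant under the cyclic shift of coordinates $(x_1,\ldots,x_n)\mapsto(x_n,x_1,\ldots,x_{n-1})$. The code with parity check matrix $P$ is $\{x: Px^T=0\}$. Distances are Hamming distances. For a code $C\subseteq\mathbb{F}_q^N$, $d(x,C)=\min_{y\in C}d(x,y)$; the covering radius is $\rho=\max_x d(x,C)$; an $[N,K,d;\rho]_q$ code is a linear code of length $N$, dimension $K$, minimum distance $d$ and covering radius $\rho$ over $\mathbb{F}_q$. Let $C(i)=\{x\in\mathbb{F}_q^N: d(x,C)=i\}$ for $0\le i\le\rho$. Two vectors are neighbors if they are at distance $1$. $C$ is completely regular if for every $l\in\{0,\ldots,\rho\}$ every $x\in C(l)$ has the same number $c_l$ of neighbors in $C(l-1)$ and the same number $b_l$ of neighbors in $C(l+1)$ (with $c_0=b_\rho=0$). Its intersection array is $\{b_0,\ldots,b_{\rho-1};c_1,\ldots,c_\rho\}$. *)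

theory Defs
  imports "Jordan_Normal_Form.Matrix_Kernel" "HOL-Library.Cardinality"
begin

(* The alphabet F_q is a type of sort {field, finite}, with q = CARD('a); words of length N are the
   elements of carrier_vec N. Coordinates and columns are numbered from 0. The code with parity
   check matrix P is mat_kernel P. *)

abbreviation subspace_dim :: "nat \<Rightarrow> 'a::field vec set \<Rightarrow> nat" where
  "subspace_dim N W \<equiv>
     vectorspace.dim (class_ring :: 'a ring) (module_vec TYPE('a) N \<lparr>carrier := W\<rparr>)"

definition linear_code :: "nat \<Rightarrow> 'a::field vec set \<Rightarrow> bool" where
  "linear_code N C \<longleftrightarrow> subspace (class_ring :: 'a ring) C (module_vec TYPE('a) N)"

definition hamming_dist :: "'a vec \<Rightarrow> 'a vec \<Rightarrow> nat" where
  "hamming_dist x y = card {i. i < dim_vec x \<and> x $ i \<noteq> y $ i}"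

definition code_dist :: "'a vec \<Rightarrow> 'a vec set \<Rightarrow> nat" where
  "code_dist x C = Min ((\<lambda>y. hamming_dist x y) ` C)"

definition min_distance :: "'a vec set \<Rightarrow> nat" where
  "min_distance C = Min {hamming_dist x y | x y. x \<in> C \<and> y \<in> C \<and> x \<noteq> y}"

definition covering_radius :: "nat \<Rightarrow> 'a vec set \<Rightarrow> nat" where
  "covering_radius N C = Max ((\<lambda>x. code_dist x C) ` carrier_vec N)"

definition code_params ::
  "nat \<Rightarrow> nat \<Rightarrow> nat \<Rightarrow> nat \<Rightarrow> 'a::{field,finite} vec set \<Rightarrow> bool" where
  "code_params N K d r C \<longleftrightarrow>
     linear_code N C \<and> subspace_dim N C = K \<and> min_distance C = d \<and> covering_radius N C = r"

definition dist_layer :: "nat \<Rightarrow> 'a vec set \<Rightarrow> nat \<Rightarrow> 'a vec set" where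
  "dist_layer N C i = {x \<in> carrier_vec N. code_dist x C = i}"

definition neighbors_in :: "'a vec \<Rightarrow> 'a vec set \<Rightarrow> nat" where
  "neighbors_in x S = card {y \<in> S. hamming_dist x y = 1}"

(* b l counts the neighbours one layer up and c l those one layer down. The case l = 0 is excluded
   for c because l - 1 is truncated; for l = covering radius the layer above is empty. *)
definition intersection_numbers ::
  "nat \<Rightarrow> 'a vec set \<Rightarrow> (nat \<Rightarrow> nat) \<Rightarrow> (nat \<Rightarrow> nat) \<Rightarrow> bool" where
  "intersection_numbers N C b c \<longleftrightarrow>
     (\<forall>l \<le> covering_radius N C. \<forall>x \<in> dist_layer N C l.
        (l > 0 \<longrightarrow> neighbors_in x (dist_layer N C (l - 1)) = c l) \<and>
        neighbors_in x (dist_layer N C (l + 1)) = b l) \<and>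
     c 0 = 0 \<and> b (covering_radius N C) = 0"

definition completely_regular :: "nat \<Rightarrow> 'a vec set \<Rightarrow> bool" where
  "completely_regular N C \<longleftrightarrow> (\<exists>b c. intersection_numbers N C b c)"

(* The array {b_0, ..., b_(rho-1); c_1, ..., c_rho} as the pair of lists bs, cs. *)
definition has_intersection_array ::
  "nat \<Rightarrow> 'a vec set \<Rightarrow> nat list \<Rightarrow> nat list \<Rightarrow> bool" where
  "has_intersection_array N C bs cs \<longleftrightarrow>
     (\<exists>b c. intersection_numbers N C b c \<and>
        bs = map b [0..<covering_radius N C] \<and> cs = map c [1..<covering_radius N C + 1])"

(* Each one-dimensional subspace of F_q^k is spanned by exactly one column. A zero column is
   impossible since its span is not one-dimensional. *)
definition hamming_check_matrix :: "nat \<Rightarrow> nat \<Rightarrow> 'a::{field,finite} mat \<Rightarrow> bool" where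
  "hamming_check_matrix k n P \<longleftrightarrow>
     P \<in> carrier_mat k n \<and>
     bij_betw
       (\<lambda>j. LinearCombinations.module.span (class_ring :: 'a ring) (module_vec TYPE('a) k) {col P j})
       {..<n}
       {W. subspace (class_ring :: 'a ring) W (module_vec TYPE('a) k) \<and> subspace_dim k W = 1}"

(* The division is exact. *)
definition hamming_code :: "nat \<Rightarrow> 'a::{field,finite} vec set \<Rightarrow> bool" where
  "hamming_code n C \<longleftrightarrow>
     (\<exists>k P. k \<ge> 1 \<and> n = (CARD('a) ^ k - 1) div (CARD('a) - 1) \<and>
        hamming_check_matrix k n P \<and> C = mat_kernel P)"

definition cyclic_shift :: "'a vec \<Rightarrow> 'a vec" where
  "cyclic_shift x = vec (dim_vec x) (\<lambda>j. x $ ((j + dim_vec x - 1) mod dim_vec x))"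

definition cyclic_code :: "'a vec set \<Rightarrow> bool" where
  "cyclic_code C \<longleftrightarrow> (\<forall>x \<in> C. cyclic_shift x \<in> C)"

definition shift_cols :: "'a mat \<Rightarrow> 'a mat" where
  "shift_cols A =
     mat (dim_row A) (dim_col A) (\<lambda>(r, j). A $$ (r, (j + dim_col A - 1) mod dim_col A))"

(* Column j lies in block column j div n, at position j mod n within the block. *)
definition extended_check_matrix :: "'a::zero mat \<Rightarrow> nat \<Rightarrow> 'a mat" where
  "extended_check_matrix H c =
     (let k = dim_row H; n = dim_col H; Z = 0\<^sub>m k n;
          top = [H, Z, H] @ replicate c H;
          bot = [Z, H, H] @ map (\<lambda>i. (shift_cols ^^ i) H) [1..<c + 1]
      in mat (2 * k) ((c + 3) * n)
           (\<lambda>(r, j). if r < k then (top ! (j div n)) $$ (r, j mod n)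
                     else (bot ! (j div n)) $$ (r - k, j mod n)))"

end

(* Let L_b be the set of scalar multiples of the columns in block b of the check matrix M. Cyclicity
   gives ker H <= ker H_i, so a linear relation between columns of H also holds between the columns of
   every block; since the columns of H represent all points of F_q^k, each L_b is a subspace of
   dimension k. The columns of M are pairwise independent, hence the c + 3 subspaces L_b meet pairwise
   in 0 only and form a partial spread of F_q^2k: any two of them are complementary. Neighbours of a
   word correspond to adding nonzero elements of the union D of the L_b to its syndrome, so the
   intersection numbers count the pairs (d, s + d) in D x D. A nonzero s splits uniquely along each
   ordered pair of distinct blocks that avoid it, which gives (c + 3)(c + 2) pairs if s lies outside D
   and (c + 2)(c + 1) + q^k - 2 if s lies in one block. Finally D covers all nonzero syndromes exactly
   when c + 1 = n(q - 1), that is, q = 2 and c = n - 1. *)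

theory Submission
  imports Defs
begin

section \<open>Subspaces of finite coordinate spaces\<close>

text \<open>The hypothesis on the code does not say that \<open>H\<close> itself is a Hamming check
  matrix: it provides some matrix with the same kernel. The two properties needed of
  \<open>H\<close> are therefore recovered indirectly. Pairwise independence of columns is a
  statement about kernel words of weight at most 2, so it passes from one check matrix to the other;
  that every point occurs then follows by counting, because n(q - 1) = q^k - 1. The bound c <= n - 1
  keeps the columns of the extended matrix pairwise independent: in two blocks without zero half the
  upper halves force the same column number j, and the lower halves then come from columns j - i and
  j - i' of \<open>H\<close>, which agree only if i = i' modulo n. Dimensions are handled by
  cardinalities; q^k q^k = q^2k replaces bases when two blocks are shown complementary.
  Complementarity of blocks 0 and 1 makes the syndrome map onto, whence codimension 2k, and splits a
  column of block 2 into two nonzero parts, whence a codeword of weight 3.\<close>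

lemma (in vectorspace) card_carrier_eq_power_dim:
  assumes "fin_dim"
  shows "card (carrier V) = card (carrier K) ^ dim"
proof -
  obtain B where B: "finite B" "basis B"
    using finite_basis_exists[OF assms] by blast
  then have sub: "B \<subseteq> carrier V"
    unfolding basis_def by blast
  have uniq: "\<exists>!a. a \<in> B \<rightarrow>\<^sub>E carrier K \<and> lincomb a B = v" if "v \<in> carrier V" for v
    using basis_criterion[OF B(1) sub] B(2) that by blast
  have "lincomb a B \<in> carrier V" if "a \<in> B \<rightarrow>\<^sub>E carrier K" for a
    using that sub by (intro lincomb_closed) auto
  then have "bij_betw (\<lambda>a. lincomb a B) (B \<rightarrow>\<^sub>E carrier K) (carrier V)"
    using uniq unfolding bij_betw_def inj_on_def image_def by blast
  then have "card (carrier V) = card (B \<rightarrow>\<^sub>E carrier K)"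
    by (simp add: bij_betw_same_card)
  also have "\<dots> = card (carrier K) ^ card B"
    using B(1) by (simp add: card_PiE)
  finally show ?thesis
    using dim_basis[OF B] by simp
qed

lemma card_field_ge_2: "2 \<le> CARD('a::{field,finite})"
  using card_mono[of "UNIV :: 'a set" "{0, 1}"] by simp

lemma card_carrier_vec: "card (carrier_vec n :: 'a::{field,finite} vec set) = CARD('a) ^ n"
proof -
  interpret vec_space "TYPE('a)" n .
  show ?thesis
    using card_carrier_eq_power_dim[OF fin_dim] by (simp add: dim_is_n)
qed

lemma finite_carrier_vec: "finite (carrier_vec n :: 'a::{field,finite} vec set)"
  by (rule card_ge_0_finite) (simp add: card_carrier_vec)

lemma subspace_vec_iff:
  "subspace (class_ring :: 'a::field ring) W (module_vec TYPE('a) n) \<longleftrightarrow>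
     W \<subseteq> carrier_vec n \<and> 0\<^sub>v n \<in> W \<and> (\<forall>u\<in>W. \<forall>v\<in>W. u + v \<in> W) \<and>
     (\<forall>a. \<forall>v\<in>W. a \<cdot>\<^sub>v v \<in> W)"
  using vec_vs[where ?'a = 'a, of n] vec_module[where ?'a = 'a, of n]
  unfolding subspace_def submodule_def by (auto simp: module_vec_def)

text \<open>Since q >= 2, the cardinality determines the dimension, so every use of
  \<open>subspace_dim\<close> can be decided by counting.\<close>

lemma card_subspace_vec:
  fixes W :: "'a::{field,finite} vec set"
  assumes "subspace class_ring W (module_vec TYPE('a) n)"
  shows "card W = CARD('a) ^ subspace_dim n W"
proof -
  interpret V: vec_space "TYPE('a)" n .
  interpret W: vectorspace class_ring "V.V\<lparr>carrier := W\<rparr>"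
    using assms by (rule V.subspace_is_vs)
  have "finite W"
    using assms finite_subset[OF _ finite_carrier_vec] by (auto simp: subspace_vec_iff)
  \<comment> \<open>A finite space is its own finite generating set, which is what
    \<open>fin_dim\<close> asks for.\<close>
  moreover have "W.span W = W"
    using W.in_own_span[of W] W.span_is_subset2[of W] by auto
  ultimately have "W.fin_dim"
    unfolding W.fin_dim_def by auto
  then show ?thesis
    using W.card_carrier_eq_power_dim by simp
qed

lemma span_singleton_vec:
  fixes v :: "'a::field vec"
  assumes "v \<in> carrier_vec n"
  shows "LinearCombinations.module.span class_ring (module_vec TYPE('a) n) {v} =
    range (\<lambda>a. a \<cdot>\<^sub>v v)"
proof -
  interpret vec_space "TYPE('a)" n .
  have lc: "lincomb a {v} = a v \<cdot>\<^sub>v v" for a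
    using assms unfolding lincomb_def by (auto simp: finsum_insert)
  have "span {v} = {lincomb a {v} | a. True}"
    using assms by (subst finite_span) auto
  also have "\<dots> = range (\<lambda>a. a \<cdot>\<^sub>v v)"
    unfolding lc by (auto intro: exI[of _ "\<lambda>_. _"])
  finally show ?thesis .
qed

lemma subspace_dim_eq_1_iff:
  fixes W :: "'a::{field,finite} vec set"
  assumes "subspace class_ring W (module_vec TYPE('a) n)"
  shows "subspace_dim n W = 1 \<longleftrightarrow> card W = CARD('a)"
  using card_subspace_vec[OF assms] card_field_ge_2[where ?'a = 'a]
    power_inject_exp[of "CARD('a)" "subspace_dim n W" 1] by simp

lemma smult_vec_left_inj:
  fixes v :: "'a::field vec"
  assumes "v \<in> carrier_vec n" "v \<noteq> 0\<^sub>v n" "a \<cdot>\<^sub>v v = b \<cdot>\<^sub>v v"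
  shows "a = b"
proof -
  obtain i where "i < n" "v $ i \<noteq> 0"
    using assms(1,2) by (metis carrier_vecD eq_vecI index_zero_vec)
  moreover have "(a \<cdot>\<^sub>v v) $ i = (b \<cdot>\<^sub>v v) $ i"
    using assms(3) by simp
  ultimately show ?thesis
    using assms(1) by auto
qed

text \<open>A subspace with q elements contains a nonzero vector, whose q distinct multiples already
  exhaust it. This makes the target of the bijection in \<open>hamming_check_matrix\<close>
  concrete.\<close>

lemma one_dim_subspaces_vec:
  "{W. subspace (class_ring :: 'a::{field,finite} ring) W (module_vec TYPE('a) n) \<and>
       subspace_dim n W = 1} =
   {range (\<lambda>a. a \<cdot>\<^sub>v v) | v. v \<in> carrier_vec n \<and> v \<noteq> 0\<^sub>v n}" (is "?L = ?R")
proof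
  show "?R \<subseteq> ?L"
  proof clarify
    fix v :: "'a vec"
    assume v: "v \<in> carrier_vec n" "v \<noteq> 0\<^sub>v n"
    have sub: "subspace class_ring (range (\<lambda>a. a \<cdot>\<^sub>v v)) (module_vec TYPE('a) n)"
    proof -
      have "0\<^sub>v n = 0 \<cdot>\<^sub>v v"
        using v(1) by auto
      then show ?thesis
        unfolding subspace_vec_iff using v(1)
        by (auto simp: image_iff smult_smult_assoc add_smult_distrib_vec[symmetric])
    qed
    have "card (range (\<lambda>a. a \<cdot>\<^sub>v v)) = CARD('a)"
      using smult_vec_left_inj[OF v] by (intro card_image) (auto intro: injI)
    then show "subspace class_ring (range (\<lambda>a. a \<cdot>\<^sub>v v)) (module_vec TYPE('a) n) \<and>
        subspace_dim n (range (\<lambda>a. a \<cdot>\<^sub>v v)) = 1"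
      using sub subspace_dim_eq_1_iff[OF sub] by simp
  qed
  show "?L \<subseteq> ?R"
  proof clarify
    fix W :: "'a vec set"
    assume sub: "subspace class_ring W (module_vec TYPE('a) n)" and "subspace_dim n W = 1"
    then have W: "card W = CARD('a)"
      using subspace_dim_eq_1_iff by blast
    have "W \<noteq> {0\<^sub>v n}"
      using W card_field_ge_2[where ?'a = 'a] by auto
    then obtain v where v: "v \<in> W" "v \<noteq> 0\<^sub>v n"
      using sub by (auto simp: subspace_vec_iff)
    have vc: "v \<in> carrier_vec n"
      using v sub by (auto simp: subspace_vec_iff)
    have "card (range (\<lambda>a. a \<cdot>\<^sub>v v)) = CARD('a)"
      using smult_vec_left_inj[OF vc v(2)] by (intro card_image) (auto intro: injI)
    moreover have "range (\<lambda>a. a \<cdot>\<^sub>v v) \<subseteq> W"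
      using sub v by (auto simp: subspace_vec_iff)
    moreover have "finite W"
      using W card_field_ge_2[where ?'a = 'a] by (intro card_ge_0_finite) simp
    ultimately have "W = range (\<lambda>a. a \<cdot>\<^sub>v v)"
      using W card_subset_eq by metis
    then show "\<exists>v. W = range (\<lambda>a. a \<cdot>\<^sub>v v) \<and> v \<in> carrier_vec n \<and> v \<noteq> 0\<^sub>v n"
      using vc v by blast
  qed
qed

section \<open>Pairwise independent columns\<close>

text \<open>Allowing \<open>b = 0\<close> and \<open>i = j\<close> excludes zero columns as well.
  The condition amounts to saying that no nonzero word of the kernel has weight at most 2.\<close>

definition independent_columns :: "'a::field mat \<Rightarrow> bool" where
  "independent_columns M \<longleftrightarrow>
     (\<forall>i<dim_col M. \<forall>j<dim_col M. \<forall>a b.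
        a \<noteq> 0 \<longrightarrow> a \<cdot>\<^sub>v col M i = b \<cdot>\<^sub>v col M j \<longrightarrow> i = j \<and> a = b)"

text \<open>These are the syndromes of the words of weight one.\<close>

definition scaled_columns :: "'a::field mat \<Rightarrow> 'a vec set" where
  "scaled_columns M = {a \<cdot>\<^sub>v col M j | a j. a \<noteq> 0 \<and> j < dim_col M}"

lemma independent_columnsD:
  assumes "independent_columns M" "a \<cdot>\<^sub>v col M i = b \<cdot>\<^sub>v col M j" "a \<noteq> 0"
    "i < dim_col M" "j < dim_col M"
  shows "i = j" "a = b"
  using assms(1)[unfolded independent_columns_def, rule_format, OF assms(4,5,3,2)] by simp_all

lemma independent_columns_nonzero:
  assumes "independent_columns M" "a \<noteq> 0" "j < dim_col M"
  shows "a \<cdot>\<^sub>v col M j \<noteq> 0\<^sub>v (dim_row M)"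
proof
  assume "a \<cdot>\<^sub>v col M j = 0\<^sub>v (dim_row M)"
  then have "a \<cdot>\<^sub>v col M j = 0 \<cdot>\<^sub>v col M j"
    by (auto simp: vec_eq_iff)
  then show False
    using independent_columnsD(2)[OF assms(1)] assms(2,3) by blast
qed

lemma scaled_columns_carrier: "M \<in> carrier_mat m N \<Longrightarrow> scaled_columns M \<subseteq> carrier_vec m"
  unfolding scaled_columns_def by auto

lemma zero_notin_scaled_columns:
  "independent_columns M \<Longrightarrow> 0\<^sub>v (dim_row M) \<notin> scaled_columns M"
  unfolding scaled_columns_def by (auto dest: independent_columns_nonzero[THEN not_sym])

lemma smult_scaled_columns:
  assumes "u \<in> scaled_columns M" "a \<noteq> 0"
  shows "a \<cdot>\<^sub>v u \<in> scaled_columns M"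
proof -
  obtain b j where "b \<noteq> 0" "j < dim_col M" "u = b \<cdot>\<^sub>v col M j"
    using assms(1) unfolding scaled_columns_def by blast
  then have "a \<cdot>\<^sub>v u = (a * b) \<cdot>\<^sub>v col M j" "a * b \<noteq> 0" "j < dim_col M"
    using assms(2) by (auto simp: smult_smult_assoc)
  then show ?thesis
    unfolding scaled_columns_def by blast
qed

lemma uminus_vec_eq_smult: "- (v :: 'a::comm_ring_1 vec) = (- 1) \<cdot>\<^sub>v v"
  by (intro eq_vecI) auto

lemma uminus_scaled_columns: "u \<in> scaled_columns M \<Longrightarrow> - u \<in> scaled_columns M"
  by (simp add: uminus_vec_eq_smult smult_scaled_columns)

lemma card_scaled_columns:
  fixes M :: "'a::{field,finite} mat"
  assumes "independent_columns M"
  shows "card (scaled_columns M) = (CARD('a) - 1) * dim_col M"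
proof -
  have "scaled_columns M = (\<lambda>(a, j). a \<cdot>\<^sub>v col M j) ` ((UNIV - {0}) \<times> {..<dim_col M})"
    unfolding scaled_columns_def by auto
  moreover have "inj_on (\<lambda>(a, j). a \<cdot>\<^sub>v col M j) ((UNIV - {0}) \<times> {..<dim_col M})"
    by (rule inj_onI) (auto dest: independent_columnsD[OF assms])
  ultimately show ?thesis
    by (simp add: card_image card_cartesian_product card_Diff_subset)
qed

text \<open>Independence makes all (q - 1)N multiples distinct and nonzero, so they fill the space
  by counting. Applied to \<open>H\<close> to see that its columns meet every point, and to the
  extended matrix in case (i).\<close>

lemma scaled_columns_eq_nonzero_vectors:
  fixes M :: "'a::{field,finite} mat"
  assumes "M \<in> carrier_mat m N" "independent_columns M" "(CARD('a) - 1) * N = CARD('a) ^ m - 1"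
  shows "scaled_columns M = carrier_vec m - {0\<^sub>v m}"
proof (rule card_subset_eq)
  show "finite (carrier_vec m - {0\<^sub>v m :: 'a vec})"
    by (simp add: finite_carrier_vec)
  show "scaled_columns M \<subseteq> carrier_vec m - {0\<^sub>v m}"
    using scaled_columns_carrier[OF assms(1)] zero_notin_scaled_columns[OF assms(2)] assms(1)
    by auto
  show "card (scaled_columns M) = card (carrier_vec m - {0\<^sub>v m :: 'a vec})"
    using assms by (simp add: card_scaled_columns finite_carrier_vec card_carrier_vec)
qed

text \<open>Proportional nonzero columns span the same point, and the bijection allows each point
  only one column; the scalars then agree because the column is not zero.\<close>

lemma hamming_check_matrix_independent_columns:
  assumes "hamming_check_matrix k n P"
  shows "independent_columns P"
  unfolding independent_columns_def
proof (intro allI impI)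
  fix i j a b
  assume ij: "i < dim_col P" "j < dim_col P" and a: "a \<noteq> 0"
    and eq: "a \<cdot>\<^sub>v col P i = b \<cdot>\<^sub>v col P j"
  have P: "P \<in> carrier_mat k n"
    and bij: "bij_betw (\<lambda>j. range (\<lambda>c. c \<cdot>\<^sub>v col P j)) {..<n}
      {range (\<lambda>c. c \<cdot>\<^sub>v v) | v. v \<in> carrier_vec k \<and> v \<noteq> 0\<^sub>v k}"
    using assms unfolding hamming_check_matrix_def one_dim_subspaces_vec
    by (auto simp: span_singleton_vec cong: bij_betw_cong)
  have nz: "col P j \<noteq> 0\<^sub>v k" if "j < n" for j
  proof
    assume zero: "col P j = 0\<^sub>v k"
    have "range (\<lambda>c. c \<cdot>\<^sub>v col P j) \<in>
        {range (\<lambda>c. c \<cdot>\<^sub>v v) | v. v \<in> carrier_vec k \<and> v \<noteq> 0\<^sub>v k}"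
      using bij that unfolding bij_betw_def by auto
    then obtain v where v: "v \<noteq> 0\<^sub>v k"
        and range: "range (\<lambda>c. c \<cdot>\<^sub>v col P j) = range (\<lambda>c. c \<cdot>\<^sub>v v)"
      by blast
    have "1 \<cdot>\<^sub>v v \<in> range (\<lambda>c. c \<cdot>\<^sub>v col P j)"
      unfolding range by blast
    then show False
      using v unfolding zero by auto
  qed
  have carr: "col P i \<in> carrier_vec k" "col P j \<in> carrier_vec k"
    using P ij by auto
  \<comment> \<open>Both scalars must be invertible for the two spans to contain each other.\<close>
  have b: "b \<noteq> 0"
  proof
    assume "b = 0"
    then have "a \<cdot>\<^sub>v col P i = 0 \<cdot>\<^sub>v col P i"
      using eq carr by (auto simp: vec_eq_iff)
    then show False
      using smult_vec_left_inj[OF carr(1) nz] a P ij by auto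
  qed
  have "c \<cdot>\<^sub>v col P i = (c / a * b) \<cdot>\<^sub>v col P j" for c
    using arg_cong[OF eq, of "\<lambda>v. (c / a) \<cdot>\<^sub>v v"] a by (simp add: smult_smult_assoc)
  moreover have "c \<cdot>\<^sub>v col P j = (c / b * a) \<cdot>\<^sub>v col P i" for c
    using arg_cong[OF eq, of "\<lambda>v. (c / b) \<cdot>\<^sub>v v"] b by (simp add: smult_smult_assoc)
  ultimately have "range (\<lambda>c. c \<cdot>\<^sub>v col P i) = range (\<lambda>c. c \<cdot>\<^sub>v col P j)"
    by blast
  then have "i = j"
    using bij P ij unfolding bij_betw_def inj_on_def by auto
  then show "i = j \<and> a = b"
    using eq smult_vec_left_inj[OF carr(1) nz] P ij by auto
qed

text \<open>Converse direction, used for case (i): independence makes the map from columns to points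
  injective, and exhaustion of the nonzero vectors makes it surjective.\<close>

lemma hamming_check_matrixI:
  fixes P :: "'a::{field,finite} mat"
  assumes P: "P \<in> carrier_mat k n" and ind: "independent_columns P"
    and all: "scaled_columns P = carrier_vec k - {0\<^sub>v k}"
  shows "hamming_check_matrix k n P"
proof -
  have sp: "LinearCombinations.module.span class_ring (module_vec TYPE('a) k) {col P j} =
      range (\<lambda>c. c \<cdot>\<^sub>v col P j)" if "j < n" for j
    using P that by (intro span_singleton_vec) auto
  have "bij_betw (\<lambda>j. range (\<lambda>c. c \<cdot>\<^sub>v col P j)) {..<n}
      {range (\<lambda>c. c \<cdot>\<^sub>v v) | v. v \<in> carrier_vec k \<and> v \<noteq> 0\<^sub>v k}"
    unfolding bij_betw_def
  proof
    show "inj_on (\<lambda>j. range (\<lambda>c. c \<cdot>\<^sub>v col P j)) {..<n}"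
    proof (rule inj_onI)
      fix i j
      assume ij: "i \<in> {..<n}" "j \<in> {..<n}"
        and "range (\<lambda>c. c \<cdot>\<^sub>v col P i) = range (\<lambda>c. c \<cdot>\<^sub>v col P j)"
      then have "1 \<cdot>\<^sub>v col P i \<in> range (\<lambda>c. c \<cdot>\<^sub>v col P j)"
        by blast
      then show "i = j"
        using independent_columnsD(1)[OF ind, of 1 i _ j] P ij by auto
    qed
    show "(\<lambda>j. range (\<lambda>c. c \<cdot>\<^sub>v col P j)) ` {..<n} =
      {range (\<lambda>c. c \<cdot>\<^sub>v v) | v. v \<in> carrier_vec k \<and> v \<noteq> 0\<^sub>v k}" (is "?L = ?R")
    proof
      show "?L \<subseteq> ?R"
      proof clarify
        fix j
        assume "j < n"
        then have "col P j \<in> carrier_vec k" "col P j \<noteq> 0\<^sub>v k"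
          using independent_columns_nonzero[OF ind, of 1 j] P by auto
        then show "\<exists>v. range (\<lambda>c. c \<cdot>\<^sub>v col P j) = range (\<lambda>c. c \<cdot>\<^sub>v v) \<and>
            v \<in> carrier_vec k \<and> v \<noteq> 0\<^sub>v k"
          by blast
      qed
      show "?R \<subseteq> ?L"
      proof clarify
        fix v :: "'a vec"
        assume "v \<in> carrier_vec k" "v \<noteq> 0\<^sub>v k"
        then obtain a j where aj: "a \<noteq> 0" "j < n" "v = a \<cdot>\<^sub>v col P j"
          using all P unfolding scaled_columns_def by blast
        have "c \<cdot>\<^sub>v col P j = (c / a) \<cdot>\<^sub>v v" "c \<cdot>\<^sub>v v = (c * a) \<cdot>\<^sub>v col P j" for c
          using aj by (auto simp: smult_smult_assoc)
        then have "range (\<lambda>c. c \<cdot>\<^sub>v v) = range (\<lambda>c. c \<cdot>\<^sub>v col P j)"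
          by blast
        then show "range (\<lambda>c. c \<cdot>\<^sub>v v) \<in> ?L"
          using aj by blast
      qed
    qed
  qed
  then have "bij_betw (\<lambda>j. LinearCombinations.module.span class_ring (module_vec TYPE('a) k) {col P j})
      {..<n} {range (\<lambda>c. c \<cdot>\<^sub>v v) | v. v \<in> carrier_vec k \<and> v \<noteq> 0\<^sub>v k}"
    by (subst bij_betw_cong[OF sp]) auto
  then show ?thesis
    using P unfolding hamming_check_matrix_def one_dim_subspaces_vec by blast
qed

lemma mult_mat_smult_unit_vec:
  fixes M :: "'a::field mat"
  assumes "M \<in> carrier_mat m N" "j < N"
  shows "M *\<^sub>v (a \<cdot>\<^sub>v unit_vec N j) = a \<cdot>\<^sub>v col M j"
  using assms by (intro eq_vecI) (auto simp: scalar_prod_right_unit)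

text \<open>Relations between two columns are kernel words supported on two coordinates, so they
  depend on the code and not on the chosen check matrix.\<close>

lemma smult_col_eq_iff:
  fixes M :: "'a::field mat"
  assumes M: "M \<in> carrier_mat m N" and ij: "i < N" "j < N"
  shows "a \<cdot>\<^sub>v col M i = b \<cdot>\<^sub>v col M j \<longleftrightarrow>
    a \<cdot>\<^sub>v unit_vec N i - b \<cdot>\<^sub>v unit_vec N j \<in> mat_kernel M"
proof -
  have "M *\<^sub>v (a \<cdot>\<^sub>v unit_vec N i - b \<cdot>\<^sub>v unit_vec N j) = a \<cdot>\<^sub>v col M i - b \<cdot>\<^sub>v col M j"
    using mult_minus_distrib_mat_vec[OF M] mult_mat_smult_unit_vec[OF M] ij by simp
  moreover have "a \<cdot>\<^sub>v col M i - b \<cdot>\<^sub>v col M j = 0\<^sub>v m \<longleftrightarrow> a \<cdot>\<^sub>v col M i = b \<cdot>\<^sub>v col M j"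
    using M by (auto simp: vec_eq_iff)
  ultimately show ?thesis
    unfolding mat_kernel[OF M] by auto
qed

lemma independent_columns_kernel_eq:
  fixes P M :: "'a::field mat"
  assumes "P \<in> carrier_mat k n" "M \<in> carrier_mat m n" "mat_kernel P = mat_kernel M"
    "independent_columns P"
  shows "independent_columns M"
  unfolding independent_columns_def
proof (intro allI impI)
  fix i j a b
  assume ij: "i < dim_col M" "j < dim_col M" and a: "a \<noteq> 0"
    and "a \<cdot>\<^sub>v col M i = b \<cdot>\<^sub>v col M j"
  then have "a \<cdot>\<^sub>v col P i = b \<cdot>\<^sub>v col P j"
    using smult_col_eq_iff[OF assms(1)] smult_col_eq_iff[OF assms(2)] assms(2,3) by simp
  then show "i = j \<and> a = b"
    using independent_columnsD[OF assms(4) _ a] ij assms(1,2) by simp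
qed

section \<open>Syndromes and distances\<close>

lemma hamming_dist_commute:
  "dim_vec x = dim_vec y \<Longrightarrow> hamming_dist x y = hamming_dist y x"
  unfolding hamming_dist_def by (metis (no_types, lifting))

lemma hamming_dist_eq_0_iff:
  "x \<in> carrier_vec N \<Longrightarrow> y \<in> carrier_vec N \<Longrightarrow> hamming_dist x y = 0 \<longleftrightarrow> x = y"
  unfolding hamming_dist_def by (auto simp: vec_eq_iff)

lemma hamming_dist_triangle:
  assumes "dim_vec x = dim_vec y"
  shows "hamming_dist x z \<le> hamming_dist x y + hamming_dist y z"
proof -
  have "hamming_dist x z \<le>
      card ({i. i < dim_vec x \<and> x $ i \<noteq> y $ i} \<union> {i. i < dim_vec y \<and> y $ i \<noteq> z $ i})"
    unfolding hamming_dist_def using assms by (intro card_mono) auto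
  then show ?thesis
    using card_Un_le unfolding hamming_dist_def by (rule order_trans)
qed

lemma hamming_dist_eq_1_iff:
  fixes x y :: "'a::field vec"
  assumes x: "x \<in> carrier_vec N" and y: "y \<in> carrier_vec N"
  shows "hamming_dist x y = 1 \<longleftrightarrow> (\<exists>i<N. \<exists>a. a \<noteq> 0 \<and> y = x + a \<cdot>\<^sub>v unit_vec N i)"
proof
  assume "hamming_dist x y = 1"
  then obtain i where "{i. i < N \<and> x $ i \<noteq> y $ i} = {i}"
    unfolding hamming_dist_def using x by (metis card_1_singletonE carrier_vecD)
  then have i: "i < N" "x $ i \<noteq> y $ i" and other: "\<And>j. j < N \<Longrightarrow> j \<noteq> i \<Longrightarrow> x $ j = y $ j"
    by blast+
  then have "y = x + (y $ i - x $ i) \<cdot>\<^sub>v unit_vec N i"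
    using x y by (intro eq_vecI) (auto simp: index_unit_vec)
  then show "\<exists>i<N. \<exists>a. a \<noteq> 0 \<and> y = x + a \<cdot>\<^sub>v unit_vec N i"
    using i by (metis right_minus_eq)
next
  assume "\<exists>i<N. \<exists>a. a \<noteq> 0 \<and> y = x + a \<cdot>\<^sub>v unit_vec N i"
  then obtain i a where "i < N" "a \<noteq> 0" "y = x + a \<cdot>\<^sub>v unit_vec N i"
    by blast
  then have "{i. i < dim_vec x \<and> x $ i \<noteq> y $ i} = {i}"
    using x by (auto simp: index_unit_vec split: if_splits)
  then show "hamming_dist x y = 1"
    unfolding hamming_dist_def by simp
qed

lemma hamming_dist_2E:
  fixes x y :: "'a::field vec"
  assumes x: "x \<in> carrier_vec N" and y: "y \<in> carrier_vec N" and "hamming_dist x y = 2"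
  obtains z where "z \<in> carrier_vec N" "hamming_dist x z = 1" "hamming_dist z y = 1"
proof -
  obtain i j where eq: "{i. i < N \<and> x $ i \<noteq> y $ i} = {i, j}" and "i \<noteq> j"
    using assms(3) x unfolding hamming_dist_def by (auto simp: card_2_iff)
  then have ij: "i < N" "j < N" "x $ i \<noteq> y $ i" "x $ j \<noteq> y $ j"
    by blast+
  have other: "l = i \<or> l = j" if "l < N" "x $ l \<noteq> y $ l" for l
    using eq that by blast
  \<comment> \<open>A midpoint: only one of the two differing coordinates is moved from
    \<open>x\<close> to \<open>y\<close>.\<close>
  define z where "z = vec N (\<lambda>l. if l = i then y $ l else x $ l)"
  have "{l. l < N \<and> x $ l \<noteq> z $ l} = {i}" "{l. l < N \<and> z $ l \<noteq> y $ l} = {j}"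
    using ij \<open>i \<noteq> j\<close> unfolding z_def by (auto dest: other split: if_splits)
  then show thesis
    using x by (intro that[of z]) (auto simp: hamming_dist_def z_def)
qed

lemma Min_image_eqI:
  fixes f :: "'b \<Rightarrow> nat"
  assumes "finite A" "x \<in> A" "\<And>y. y \<in> A \<Longrightarrow> f x \<le> f y"
  shows "Min (f ` A) = f x"
  using assms by (intro Min_eqI) auto

lemma finite_mat_kernel:
  fixes M :: "'a::{field,finite} mat"
  assumes "M \<in> carrier_mat m N"
  shows "finite (mat_kernel M)"
  using finite_subset[OF mat_kernel_carrier[OF assms] finite_carrier_vec] .

lemma zero_in_mat_kernel:
  fixes M :: "'a::field mat"
  shows "M \<in> carrier_mat m N \<Longrightarrow> 0\<^sub>v N \<in> mat_kernel M"
  by (rule mat_kernelI) auto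

section \<open>Neighbours and syndromes for pairwise independent columns\<close>

locale independent_check_matrix =
  fixes M :: "'a::{field,finite} mat" and m N :: nat
  assumes M: "M \<in> carrier_mat m N" and independent: "independent_columns M"
begin

abbreviation "D \<equiv> scaled_columns M"

lemma D_carrier: "d \<in> D \<Longrightarrow> d \<in> carrier_vec m"
  using scaled_columns_carrier[OF M] by blast

lemma zero_notin_D: "0\<^sub>v m \<notin> D"
  using zero_notin_scaled_columns[OF independent] M by simp

lemma finite_D: "finite D"
  using scaled_columns_carrier[OF M] finite_carrier_vec by (rule finite_subset)

lemma neighbor_syndrome:
  assumes "x \<in> carrier_vec N" "i < N"
  shows "M *\<^sub>v (x + a \<cdot>\<^sub>v unit_vec N i) = M *\<^sub>v x + a \<cdot>\<^sub>v col M i"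
  using assms mult_add_distrib_mat_vec[OF M] mult_mat_smult_unit_vec[OF M] by simp

text \<open>Changing coordinate i by a nonzero a moves the syndrome by a times column i, and
  independence says that different changes move it differently. Hence neighbours can be counted in
  \<open>D\<close> without multiplicities.\<close>

lemma bij_betw_neighbors:
  assumes x: "x \<in> carrier_vec N"
  shows "bij_betw (\<lambda>y. M *\<^sub>v y - M *\<^sub>v x) {y \<in> carrier_vec N. hamming_dist x y = 1} D"
proof -
  have "x + a \<cdot>\<^sub>v unit_vec N i \<in> carrier_vec N" for a i
    using x by simp
  then have nb: "{y \<in> carrier_vec N. hamming_dist x y = 1} =
      {x + a \<cdot>\<^sub>v unit_vec N i | a i. a \<noteq> 0 \<and> i < N}"
    using hamming_dist_eq_1_iff[OF x] by blast
  have syn: "M *\<^sub>v (x + a \<cdot>\<^sub>v unit_vec N i) - M *\<^sub>v x = a \<cdot>\<^sub>v col M i" if "i < N" for a i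
    unfolding neighbor_syndrome[OF x that] using M x by (auto simp: vec_eq_iff)
  have "inj_on (\<lambda>y. M *\<^sub>v y - M *\<^sub>v x) {x + a \<cdot>\<^sub>v unit_vec N i | a i. a \<noteq> 0 \<and> i < N}"
  proof (rule inj_onI, clarify)
    fix a i b j
    assume "a \<noteq> 0" "i < N" "b \<noteq> 0" "j < N"
      "M *\<^sub>v (x + a \<cdot>\<^sub>v unit_vec N i) - M *\<^sub>v x = M *\<^sub>v (x + b \<cdot>\<^sub>v unit_vec N j) - M *\<^sub>v x"
    then show "x + a \<cdot>\<^sub>v unit_vec N i = x + b \<cdot>\<^sub>v unit_vec N j"
      using independent_columnsD[OF independent, of a i b j] M by (simp add: syn)
  qed
  moreover have "(\<lambda>y. M *\<^sub>v y - M *\<^sub>v x) ` {x + a \<cdot>\<^sub>v unit_vec N i | a i. a \<noteq> 0 \<and> i < N} = D"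
  proof -
    have "(\<lambda>y. M *\<^sub>v y - M *\<^sub>v x) ` {x + a \<cdot>\<^sub>v unit_vec N i | a i. a \<noteq> 0 \<and> i < N} =
      {M *\<^sub>v (x + a \<cdot>\<^sub>v unit_vec N i) - M *\<^sub>v x | a i. a \<noteq> 0 \<and> i < N}"
      by blast
    also have "\<dots> = D"
      unfolding scaled_columns_def using syn M by (metis (no_types, lifting) carrier_matD(2))
    finally show ?thesis .
  qed
  ultimately show ?thesis
    unfolding bij_betw_def nb by blast
qed

text \<open>The distance layers turn out to be sets of this form, so all intersection numbers become
  counts of steps inside the syndrome space.\<close>

lemma neighbors_in_syndrome:
  assumes x: "x \<in> carrier_vec N"
  shows "neighbors_in x {y \<in> carrier_vec N. M *\<^sub>v y \<in> T} = card {d \<in> D. M *\<^sub>v x + d \<in> T}"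
proof -
  have "M *\<^sub>v x + (M *\<^sub>v y - M *\<^sub>v x) = M *\<^sub>v y" for y
    using M by (auto simp: vec_eq_iff)
  then have "bij_betw (\<lambda>y. M *\<^sub>v y - M *\<^sub>v x)
      {y \<in> {y \<in> carrier_vec N. hamming_dist x y = 1}. M *\<^sub>v y \<in> T} {d \<in> D. M *\<^sub>v x + d \<in> T}"
    by (intro bij_betw_Collect[OF bij_betw_neighbors[OF x]]) simp
  moreover have "{y \<in> {y \<in> carrier_vec N. hamming_dist x y = 1}. M *\<^sub>v y \<in> T} =
      {y \<in> {y \<in> carrier_vec N. M *\<^sub>v y \<in> T}. hamming_dist x y = 1}"
    by blast
  ultimately show ?thesis
    unfolding neighbors_in_def by (simp add: bij_betw_same_card)
qed

lemma neighbor_with_syndrome: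
  assumes "x \<in> carrier_vec N" "d \<in> D"
  obtains y where "y \<in> carrier_vec N" "hamming_dist x y = 1" "M *\<^sub>v y = M *\<^sub>v x + d"
proof -
  obtain y where "y \<in> carrier_vec N" "hamming_dist x y = 1" "d = M *\<^sub>v y - M *\<^sub>v x"
    using bij_betw_neighbors[OF assms(1)] assms(2) unfolding bij_betw_def by blast
  moreover from this have "M *\<^sub>v y = M *\<^sub>v x + d"
    using M by (auto simp: vec_eq_iff)
  ultimately show thesis
    using that by blast
qed

text \<open>The step to the codeword changes the syndrome by its negative, and \<open>D\<close> is
  symmetric.\<close>

lemma codeword_neighbor_syndrome:
  assumes "x \<in> carrier_vec N" "y \<in> mat_kernel M" "hamming_dist x y = 1"
  shows "M *\<^sub>v x \<in> D"
proof -
  have y: "y \<in> carrier_vec N" "M *\<^sub>v y = 0\<^sub>v m"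
    using mat_kernelD[OF M assms(2)] .
  have "M *\<^sub>v y - M *\<^sub>v x \<in> D"
    using bij_betwE[OF bij_betw_neighbors[OF assms(1)]] y(1) assms(3) by blast
  then have "- (0\<^sub>v m - M *\<^sub>v x) \<in> D"
    unfolding y(2) by (rule uminus_scaled_columns)
  moreover have "- (0\<^sub>v m - M *\<^sub>v x) = M *\<^sub>v x"
    using M by (auto simp: vec_eq_iff)
  ultimately show ?thesis
    by simp
qed

text \<open>Distance 1 would put the syndrome 0 into \<open>D\<close>. Distance 2 would give a
  midpoint with two different neighbours of syndrome 0, against the injectivity in
  \<open>bij_betw_neighbors\<close>.\<close>

lemma hamming_dist_codewords_ge_3:
  assumes x: "x \<in> mat_kernel M" and y: "y \<in> mat_kernel M" and "x \<noteq> y"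
  shows "3 \<le> hamming_dist x y"
proof (rule ccontr)
  have xc: "x \<in> carrier_vec N" "M *\<^sub>v x = 0\<^sub>v m" and yc: "y \<in> carrier_vec N" "M *\<^sub>v y = 0\<^sub>v m"
    using mat_kernelD[OF M x] mat_kernelD[OF M y] by auto
  assume "\<not> 3 \<le> hamming_dist x y"
  moreover have "hamming_dist x y \<noteq> 0"
    using hamming_dist_eq_0_iff[OF xc(1) yc(1)] assms(3) by simp
  moreover have "hamming_dist x y \<noteq> 1"
    using codeword_neighbor_syndrome[OF xc(1) y] xc zero_notin_D by auto
  ultimately have "hamming_dist x y = 2"
    by simp
  then obtain z where z: "z \<in> carrier_vec N" "hamming_dist x z = 1" "hamming_dist z y = 1"
    using hamming_dist_2E[OF xc(1) yc(1)] by blast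
  then have "hamming_dist z x = 1"
    using hamming_dist_commute[of z x] xc by simp
  then show False
    using bij_betw_neighbors[OF z(1)] z xc yc assms(3) unfolding bij_betw_def inj_on_def by auto
qed

end

section \<open>Codes whose syndromes are sums of at most two elements of D\<close>

locale two_covering_check_matrix = independent_check_matrix +
  assumes two_step: "s \<in> carrier_vec m \<Longrightarrow> \<exists>u\<in>insert (0\<^sub>v m) D. \<exists>v\<in>insert (0\<^sub>v m) D. s = u + v"
begin

abbreviation "C \<equiv> mat_kernel M"

text \<open>Subtracting a summand of the syndrome is one step towards the code, which bounds the
  distance from above. From below, distance 0 means syndrome 0 and distance 1 means a syndrome in
  \<open>D\<close>.\<close>

lemma code_dist_syndrome:
  assumes x: "x \<in> carrier_vec N"
  shows "code_dist x C = (if M *\<^sub>v x = 0\<^sub>v m then 0 else if M *\<^sub>v x \<in> D then 1 else 2)"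
proof -
  have fin: "finite C"
    using finite_mat_kernel[OF M] .
  have step: "\<exists>y\<in>C. hamming_dist x y = 1" if D: "M *\<^sub>v x \<in> D" and x: "x \<in> carrier_vec N" for x
  proof -
    obtain y where y: "y \<in> carrier_vec N" "hamming_dist x y = 1" "M *\<^sub>v y = M *\<^sub>v x + - (M *\<^sub>v x)"
      using neighbor_with_syndrome[OF x uminus_scaled_columns[OF D]] by blast
    then have "y \<in> C"
      using M by (intro mat_kernelI[OF M]) (auto simp: vec_eq_iff)
    then show ?thesis
      using y by blast
  qed
  have carr: "y \<in> carrier_vec N" if "y \<in> C" for y
    using mat_kernelD(1)[OF M that] .
  have ne_0: "hamming_dist x y \<noteq> 0" if "y \<in> C" "M *\<^sub>v x \<noteq> 0\<^sub>v m" for y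
    using hamming_dist_eq_0_iff[OF x carr] mat_kernelD(2)[OF M] that by blast
  consider "M *\<^sub>v x = 0\<^sub>v m" | "M *\<^sub>v x \<in> D" | "M *\<^sub>v x \<noteq> 0\<^sub>v m" "M *\<^sub>v x \<notin> D"
    by blast
  then show ?thesis
  proof cases
    case 1
    then have "x \<in> C" "hamming_dist x x = 0"
      using x by (auto intro: mat_kernelI[OF M] simp: hamming_dist_def)
    then have "code_dist x C = hamming_dist x x"
      unfolding code_dist_def using fin by (intro Min_image_eqI) auto
    then show ?thesis
      using 1 \<open>hamming_dist x x = 0\<close> by simp
  next
    case 2
    then have nz: "M *\<^sub>v x \<noteq> 0\<^sub>v m"
      using zero_notin_D by metis
    obtain y where y: "y \<in> C" "hamming_dist x y = 1"
      using step[OF 2 x] by blast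
    then have "code_dist x C = hamming_dist x y"
      unfolding code_dist_def using fin ne_0[OF _ nz]
      by (intro Min_image_eqI) (auto simp: Suc_le_eq)
    then show ?thesis
      using 2 nz y by simp
  next
    case 3
    have sc: "M *\<^sub>v x \<in> carrier_vec m"
      using M x by auto
    obtain u v where uv: "u \<in> insert (0\<^sub>v m) D" "v \<in> insert (0\<^sub>v m) D" "M *\<^sub>v x = u + v"
      using two_step[OF sc] by blast
    then have u: "u \<in> D" "v \<in> D"
      using 3 D_carrier by (metis insertE left_zero_vec right_zero_vec zero_carrier_vec)+
    \<comment> \<open>Removing \<open>u\<close> leaves the syndrome \<open>v\<close> in
      \<open>D\<close>, so \<open>z\<close> is one step away from a codeword.\<close>
    obtain z where z: "z \<in> carrier_vec N" "hamming_dist x z = 1" "M *\<^sub>v z = M *\<^sub>v x + - u"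
      using neighbor_with_syndrome[OF x uminus_scaled_columns[OF u(1)]] by blast
    moreover have "M *\<^sub>v x + - u = v"
      unfolding uv(3) using u[THEN D_carrier] by (auto simp: vec_eq_iff)
    ultimately obtain y where y: "y \<in> C" "hamming_dist z y = 1"
      using step[OF _ z(1)] u by auto
    have ge: "2 \<le> hamming_dist x y'" if "y' \<in> C" for y'
      using ne_0[OF that 3(1)] codeword_neighbor_syndrome[OF x that] 3 by force
    have "hamming_dist x y \<le> hamming_dist x z + hamming_dist z y"
      using x z(1) by (intro hamming_dist_triangle) simp
    then have "hamming_dist x y = 2"
      using ge[OF y(1)] z(2) y(2) by simp
    moreover from this have "code_dist x C = hamming_dist x y"
      unfolding code_dist_def using fin ge y by (intro Min_image_eqI) auto
    ultimately show ?thesis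
      using 3 by simp
  qed
qed

text \<open>Layer 3 is included because \<open>intersection_numbers\<close> also looks one layer
  above the covering radius.\<close>

lemma dist_layer_0: "dist_layer N C 0 = {x \<in> carrier_vec N. M *\<^sub>v x \<in> {0\<^sub>v m}}"
  and dist_layer_1: "dist_layer N C 1 = {x \<in> carrier_vec N. M *\<^sub>v x \<in> D}"
  and dist_layer_2: "dist_layer N C 2 =
    {x \<in> carrier_vec N. M *\<^sub>v x \<in> carrier_vec m - insert (0\<^sub>v m) D}"
  and dist_layer_3: "dist_layer N C 3 = {}"
  unfolding dist_layer_def using M zero_notin_D
  by (auto simp: code_dist_syndrome split: if_splits)

text \<open>Multiples of unit vectors realise \<open>D\<close>, and linearity realises sums of two
  such syndromes; full row rank follows without exhibiting independent columns.\<close>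

lemma syndrome_surj:
  assumes "s \<in> carrier_vec m"
  shows "\<exists>x\<in>carrier_vec N. M *\<^sub>v x = s"
proof -
  have ins: "\<exists>x\<in>carrier_vec N. M *\<^sub>v x = u" if "u \<in> insert (0\<^sub>v m) D" for u
  proof (cases "u = 0\<^sub>v m")
    case True
    then show ?thesis
      using mat_kernelD[OF M zero_in_mat_kernel[OF M]] by auto
  next
    case False
    then have "u \<in> D"
      using that by blast
    then obtain a j where "j < N" "u = a \<cdot>\<^sub>v col M j"
      using M unfolding scaled_columns_def by auto
    then show ?thesis
      using mult_mat_smult_unit_vec[OF M] by (metis smult_carrier_vec unit_vec_carrier)
  qed
  obtain u v where "u \<in> insert (0\<^sub>v m) D" "v \<in> insert (0\<^sub>v m) D" "s = u + v"
    using two_step[OF assms] by blast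
  moreover from this obtain x y where "x \<in> carrier_vec N" "M *\<^sub>v x = u" "y \<in> carrier_vec N" "M *\<^sub>v y = v"
    using ins by metis
  ultimately show ?thesis
    using mult_add_distrib_mat_vec[OF M] by (metis add_carrier_vec)
qed

lemma covering_radius_eq_2:
  assumes "insert (0\<^sub>v m) D \<noteq> carrier_vec m"
  shows "covering_radius N C = 2"
  unfolding covering_radius_def
proof (rule Max_eqI)
  show "finite ((\<lambda>x. code_dist x C) ` carrier_vec N)"
    by (simp add: finite_carrier_vec)
  show "y \<le> 2" if "y \<in> (\<lambda>x. code_dist x C) ` carrier_vec N" for y
    using that by (auto simp: code_dist_syndrome)
  obtain s where "s \<in> carrier_vec m" "s \<notin> insert (0\<^sub>v m) D"
    using assms D_carrier by auto
  moreover from this obtain x where "x \<in> carrier_vec N" "M *\<^sub>v x = s"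
    using syndrome_surj by blast
  ultimately show "2 \<in> (\<lambda>x. code_dist x C) ` carrier_vec N"
    using code_dist_syndrome[of x] by (auto simp: image_iff intro!: bexI[of _ x])
qed

lemma subspace_kernel: "subspace class_ring C (module_vec TYPE('a) N)"
  unfolding subspace_vec_iff
  using M mult_add_distrib_mat_vec[OF M] mat_kernel_smult[OF M]
  by (auto simp: mat_kernel[OF M])

text \<open>Rank-nullity by counting: the fibres of the syndrome map are q^m translates of the
  kernel.\<close>

lemma card_kernel: "card C * CARD('a) ^ m = CARD('a) ^ N"
proof -
  have fiber: "card {x \<in> carrier_vec N. M *\<^sub>v x = s} = card C" if s: "s \<in> carrier_vec m" for s
  proof -
    obtain z where z: "z \<in> carrier_vec N" "M *\<^sub>v z = s"
      using syndrome_surj[OF s] by blast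
    have cancel: "x + z - z = x" "x - z + z = x" if "x \<in> carrier_vec N" for x
      using that z(1) by (auto simp: vec_eq_iff)
    have "s - s = 0\<^sub>v m"
      using s by (auto simp: vec_eq_iff)
    then have syn: "M *\<^sub>v (x - z) = 0\<^sub>v m \<longleftrightarrow> M *\<^sub>v x = s" if "x \<in> carrier_vec N" for x
      using that s z M cancel
      by (metis left_zero_vec minus_carrier_vec mult_add_distrib_mat_vec mult_minus_distrib_mat_vec)
    have "bij_betw (\<lambda>x. x + z) C {x \<in> carrier_vec N. M *\<^sub>v x = s}"
    proof (rule bij_betw_byWitness[where f' = "\<lambda>x. x - z"])
      show "\<forall>x\<in>C. x + z - z = x" "\<forall>x\<in>{x \<in> carrier_vec N. M *\<^sub>v x = s}. x - z + z = x"
        using mat_kernel_carrier[OF M] cancel by auto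
      show "(\<lambda>x. x + z) ` C \<subseteq> {x \<in> carrier_vec N. M *\<^sub>v x = s}"
        using z s by (auto simp: mat_kernel[OF M] mult_add_distrib_mat_vec[OF M])
      show "(\<lambda>x. x - z) ` {x \<in> carrier_vec N. M *\<^sub>v x = s} \<subseteq> C"
        using z syn by (auto simp: mat_kernel[OF M])
    qed
    then show ?thesis
      by (simp add: bij_betw_same_card)
  qed
  have "carrier_vec N = (\<Union>s\<in>carrier_vec m. {x \<in> carrier_vec N. M *\<^sub>v x = s})"
    using M by auto
  then have "CARD('a) ^ N = card (\<Union>s\<in>carrier_vec m. {x \<in> carrier_vec N. M *\<^sub>v x = s})"
    by (metis card_carrier_vec)
  also have "\<dots> = (\<Sum>s\<in>carrier_vec m. card {x \<in> carrier_vec N. M *\<^sub>v x = s})"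
    by (intro card_UN_disjoint) (auto simp: finite_carrier_vec)
  also have "\<dots> = card C * CARD('a) ^ m"
    by (simp add: fiber card_carrier_vec)
  finally show ?thesis
    by simp
qed

text \<open>The equation \<open>subspace_dim N C + m = N\<close> obtained on the way shows
  \<open>m \<le> N\<close>, so the natural subtraction is exact.\<close>

lemma subspace_dim_kernel: "subspace_dim N C = N - m"
proof -
  have "CARD('a) ^ (subspace_dim N C + m) = CARD('a) ^ N"
    using card_kernel card_subspace_vec[OF subspace_kernel] by (simp add: power_add)
  then have "subspace_dim N C + m = N"
    using card_field_ge_2[where ?'a = 'a] by (subst (asm) power_inject_exp) auto
  then show ?thesis
    by simp
qed

text \<open>From a syndrome s in \<open>D\<close>, exactly the step - s leads to 0 and p steps stay
  in \<open>D\<close>; the remaining \<open>card D - 1 - p\<close> lead up. From 0 all steps lead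
  into \<open>D\<close>. The default value 0 of the two functions supplies \<open>c 0 = 0\<close>
  and the vanishing of \<open>b\<close> at the covering radius 2.\<close>

lemma intersection_numbers_syndrome:
  assumes "insert (0\<^sub>v m) D \<noteq> carrier_vec m"
    and D1: "\<And>s. s \<in> D \<Longrightarrow> card {d \<in> D. s + d \<in> D} = p"
    and D2: "\<And>s. s \<in> carrier_vec m - insert (0\<^sub>v m) D \<Longrightarrow> card {d \<in> D. s + d \<in> D} = r"
  shows "intersection_numbers N C ((\<lambda>_. 0)(0 := card D, 1 := card D - 1 - p))
    ((\<lambda>_. 0)(1 := 1, 2 := r))"
proof -
  have down1: "card {d \<in> D. s + d \<in> {0\<^sub>v m}} = 1" if "s \<in> D" for s
  proof -
    have "s + d = 0\<^sub>v m \<longleftrightarrow> d = - s" if "d \<in> carrier_vec m" for d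
      using that D_carrier[OF \<open>s \<in> D\<close>]
      by (auto simp: vec_eq_iff eq_neg_iff_add_eq_0 add.commute)
    then have "{d \<in> D. s + d \<in> {0\<^sub>v m}} = {- s}"
      using uminus_scaled_columns[OF that] D_carrier by auto
    then show ?thesis
      by simp
  qed
  have up1: "card {d \<in> D. s + d \<in> carrier_vec m - insert (0\<^sub>v m) D} = card D - 1 - p"
    if "s \<in> D" for s
  proof -
    have "{d \<in> D. s + d \<in> carrier_vec m - insert (0\<^sub>v m) D} =
        D - {d \<in> D. s + d \<in> {0\<^sub>v m}} - {d \<in> D. s + d \<in> D}"
      using D_carrier that by auto
    moreover have "card (D - {d \<in> D. s + d \<in> {0\<^sub>v m}}) = card D - 1"
      using down1[OF that] finite_D by (subst card_Diff_subset) auto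
    moreover have "card (D - {d \<in> D. s + d \<in> {0\<^sub>v m}} - {d \<in> D. s + d \<in> D}) =
        card (D - {d \<in> D. s + d \<in> {0\<^sub>v m}}) - p"
      using D1[OF that] finite_D zero_notin_D by (subst card_Diff_subset) auto
    ultimately show ?thesis
      by simp
  qed
  have zero: "{d \<in> D. 0\<^sub>v m + d \<in> D} = D"
    using D_carrier by auto
  have layer: "neighbors_in x (dist_layer N C (l + 1)) =
        ((\<lambda>_. 0)(0 := card D, 1 := card D - 1 - p)) l \<and>
      (l > 0 \<longrightarrow> neighbors_in x (dist_layer N C (l - 1)) = ((\<lambda>_. 0)(1 := 1, 2 := r)) l)"
    if l: "l \<le> 2" and x: "x \<in> dist_layer N C l" for l x
  proof -
    have xc: "x \<in> carrier_vec N"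
      using x unfolding dist_layer_def by blast
    consider "l = 0" | "l = 1" | "l = 2"
      using l by linarith
    then show ?thesis
    proof cases
      case 1
      then have "M *\<^sub>v x = 0\<^sub>v m"
        using x by (auto simp: dist_layer_0)
      then show ?thesis
        using 1 dist_layer_1 neighbors_in_syndrome[OF xc] zero by simp
    next
      case 2
      then have "M *\<^sub>v x \<in> D"
        using x dist_layer_1 by auto
      then have "neighbors_in x (dist_layer N C 0) = 1"
        "neighbors_in x (dist_layer N C 2) = card D - 1 - p"
        unfolding dist_layer_0 dist_layer_2 neighbors_in_syndrome[OF xc]
        by (rule down1, rule up1)
      then show ?thesis
        using 2 by (simp add: numeral_2_eq_2)
    next
      case 3
      then have "M *\<^sub>v x \<in> carrier_vec m - insert (0\<^sub>v m) D"
        using x dist_layer_2 by auto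
      then have "neighbors_in x (dist_layer N C 1) = r"
        unfolding dist_layer_1 neighbors_in_syndrome[OF xc] by (rule D2)
      moreover have "neighbors_in x (dist_layer N C 3) = 0"
        unfolding dist_layer_3 neighbors_in_def by simp
      ultimately show ?thesis
        using 3 by (simp add: numeral_2_eq_2 numeral_3_eq_3)
    qed
  qed
  then show ?thesis
    unfolding intersection_numbers_def covering_radius_eq_2[OF assms(1)] by simp
qed

text \<open>The relation between three different columns is a codeword of weight 3, which attains
  the lower bound valid for independent columns.\<close>

lemma min_distance_eq_3:
  assumes ijl: "i < N" "j < N" "l < N" "i \<noteq> j" "i \<noteq> l" "j \<noteq> l" and ab: "a \<noteq> 0" "b \<noteq> 0" "c \<noteq> 0"
    and eq: "a \<cdot>\<^sub>v col M i + b \<cdot>\<^sub>v col M j = c \<cdot>\<^sub>v col M l"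
  shows "min_distance C = 3"
  unfolding min_distance_def
proof (rule Min_eqI)
  have "{hamming_dist x y |x y. x \<in> C \<and> y \<in> C \<and> x \<noteq> y} \<subseteq> (\<lambda>(x, y). hamming_dist x y) ` (C \<times> C)"
    by auto
  then show "finite {hamming_dist x y |x y. x \<in> C \<and> y \<in> C \<and> x \<noteq> y}"
    by (rule finite_subset) (simp add: finite_mat_kernel[OF M])
  show "3 \<le> w" if "w \<in> {hamming_dist x y |x y. x \<in> C \<and> y \<in> C \<and> x \<noteq> y}" for w
    using that hamming_dist_codewords_ge_3 by blast
  define z where "z = a \<cdot>\<^sub>v unit_vec N i + b \<cdot>\<^sub>v unit_vec N j - c \<cdot>\<^sub>v unit_vec N l"
  have "M *\<^sub>v z = a \<cdot>\<^sub>v col M i + b \<cdot>\<^sub>v col M j - c \<cdot>\<^sub>v col M l"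
    unfolding z_def using ijl
    by (simp add: mult_minus_distrib_mat_vec[OF M] mult_add_distrib_mat_vec[OF M]
        mult_mat_smult_unit_vec[OF M])
  then have "M *\<^sub>v z = 0\<^sub>v m"
    unfolding eq using M by (auto simp: vec_eq_iff)
  then have z: "z \<in> C"
    by (intro mat_kernelI[OF M]) (auto simp: z_def)
  have "{t. t < N \<and> 0\<^sub>v N $ t \<noteq> z $ t} = {i, j, l}"
    using ijl ab unfolding z_def by (auto simp: index_unit_vec split: if_splits)
  then have dist: "hamming_dist (0\<^sub>v N) z = 3"
    unfolding hamming_dist_def using ijl by simp
  then have "0\<^sub>v N \<noteq> z"
    by (auto simp: hamming_dist_def)
  then show "3 \<in> {hamming_dist x y |x y. x \<in> C \<and> y \<in> C \<and> x \<noteq> y}"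
    using z dist zero_in_mat_kernel[OF M] by force
qed

end

section \<open>Partial spreads\<close>

text \<open>The set in \<open>block_add\<close> is the later \<open>L b\<close>, written out because
  it enters the assumptions. Its closure under scalars is automatic, so additivity makes it a
  subspace, and \<open>card_power\<close> makes its size q^k. The first two blocks decompose the
  space; a third one supplies the vector to be split for the minimum distance.\<close>

locale spread_check_matrix = independent_check_matrix M "2 * k" "w * n"
  for M :: "'a::{field,finite} mat" and k n w :: nat +
  assumes n_pos: "0 < n" and w_ge_3: "3 \<le> w" and card_power: "CARD('a) ^ k = (CARD('a) - 1) * n + 1"
    and block_add: "\<And>b u v. b < w \<Longrightarrow> u \<in> {a \<cdot>\<^sub>v col M (b * n + j) | a j. j < n} \<Longrightarrow>
      v \<in> {a \<cdot>\<^sub>v col M (b * n + j) | a j. j < n} \<Longrightarrow>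
      u + v \<in> {a \<cdot>\<^sub>v col M (b * n + j) | a j. j < n}"
begin

text \<open>Unlike in \<open>scaled_columns\<close>, the coefficient may be 0, so that 0 belongs to
  each block.\<close>

definition L :: "nat \<Rightarrow> 'a vec set" where
  "L b = {a \<cdot>\<^sub>v col M (b * n + j) | a j. j < n}"

lemma L_add: "b < w \<Longrightarrow> u \<in> L b \<Longrightarrow> v \<in> L b \<Longrightarrow> u + v \<in> L b"
  unfolding L_def by (rule block_add)

lemma block_index: "b < w \<Longrightarrow> j < n \<Longrightarrow> b * n + j < w * n"
  by (metis add_less_cancel_left add.commute less_le_trans mult_Suc mult_le_mono1 Suc_leI)

lemma L_carrier:
  assumes "b < w" "u \<in> L b"
  shows "u \<in> carrier_vec (2 * k)"
proof -
  obtain a j where "j < n" "u = a \<cdot>\<^sub>v col M (b * n + j)"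
    using assms(2) unfolding L_def by blast
  then show ?thesis
    using block_index[OF assms(1)] col_carrier_vec[OF _ M] by simp
qed

lemma zero_in_L: "b < w \<Longrightarrow> 0\<^sub>v (2 * k) \<in> L b"
  unfolding L_def using n_pos M by (auto intro!: exI[of _ "0 :: 'a"] exI[of _ "0 :: nat"])

lemma L_uminus: "u \<in> L b \<Longrightarrow> - u \<in> L b"
  unfolding L_def uminus_vec_eq_smult by (clarsimp simp: smult_smult_assoc) blast

text \<open>A nonzero common vector would be a multiple of one column from each block; independence
  identifies the two column indices, and division by n then identifies the blocks.\<close>

lemma L_disjoint:
  assumes "b < w" "b' < w" "b \<noteq> b'" "u \<in> L b" "u \<in> L b'"
  shows "u = 0\<^sub>v (2 * k)"
proof (rule ccontr)
  assume nz: "u \<noteq> 0\<^sub>v (2 * k)"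
  obtain a j a' j' where u: "j < n" "j' < n" "u = a \<cdot>\<^sub>v col M (b * n + j)" "u = a' \<cdot>\<^sub>v col M (b' * n + j')"
    using assms unfolding L_def by blast
  then have "a \<noteq> 0"
    using nz M by (auto simp: vec_eq_iff)
  then have "b * n + j = b' * n + j'"
    using independent_columnsD(1)[OF independent, of a "b * n + j" a' "b' * n + j'"] u M
      block_index assms by simp
  then have "(b * n + j) div n = (b' * n + j') div n"
    by simp
  then show False
    using u assms n_pos by simp
qed

lemma card_L:
  assumes "b < w"
  shows "card (L b) = CARD('a) ^ k"
proof -
  define S where "S = (\<lambda>(a, j). a \<cdot>\<^sub>v col M (b * n + j)) ` ((UNIV - {0}) \<times> {..<n})"
  have ind: "j < n \<Longrightarrow> b * n + j < dim_col M" for j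
    using block_index[OF assms] M by simp
  have "inj_on (\<lambda>(a, j). a \<cdot>\<^sub>v col M (b * n + j)) ((UNIV - {0}) \<times> {..<n})"
  proof (rule inj_onI)
    fix x y
    assume "x \<in> (UNIV - {0}) \<times> {..<n}" "y \<in> (UNIV - {0}) \<times> {..<n}"
      and "(case x of (a, j) \<Rightarrow> a \<cdot>\<^sub>v col M (b * n + j)) = (case y of (a, j) \<Rightarrow> a \<cdot>\<^sub>v col M (b * n + j))"
    then show "x = y"
      using independent_columnsD[OF independent, of "fst x" "b * n + snd x" "fst y" "b * n + snd y"]
      by (simp add: case_prod_beta prod_eq_iff mem_Times_iff ind)
  qed
  then have "card S = (CARD('a) - 1) * n"
    unfolding S_def by (simp add: card_image card_cartesian_product card_Diff_subset)
  moreover have "0\<^sub>v (2 * k) \<notin> S"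
    using independent_columns_nonzero[OF independent] ind M unfolding S_def by force
  moreover have "L b = insert (0\<^sub>v (2 * k)) S"
  proof
    show "insert (0\<^sub>v (2 * k)) S \<subseteq> L b"
      using zero_in_L[OF assms] unfolding S_def L_def by auto
    show "L b \<subseteq> insert (0\<^sub>v (2 * k)) S"
    proof
      fix u
      assume "u \<in> L b"
      then obtain a j where u: "j < n" "u = a \<cdot>\<^sub>v col M (b * n + j)"
        unfolding L_def by blast
      show "u \<in> insert (0\<^sub>v (2 * k)) S"
      proof (cases "a = 0")
        case True
        then show ?thesis
          using u M by (auto simp: vec_eq_iff)
      next
        case False
        then show ?thesis
          using u unfolding S_def by (auto simp: image_iff)
      qed
    qed
  qed
  moreover have "finite S"
    unfolding S_def by simp
  ultimately show ?thesis
    by (simp add: card_power)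
qed

lemma D_eq_UN_L: "D = (\<Union>b<w. L b) - {0\<^sub>v (2 * k)}"
proof
  show "D \<subseteq> (\<Union>b<w. L b) - {0\<^sub>v (2 * k)}"
  proof
    fix d
    assume d: "d \<in> D"
    then obtain a i where ai: "i < w * n" "d = a \<cdot>\<^sub>v col M i"
      using M unfolding scaled_columns_def by auto
    then have "i div n < w" "i mod n < n" "i = (i div n) * n + i mod n"
      using n_pos by (auto simp: less_mult_imp_div_less)
    then have "d \<in> L (i div n)"
      using ai(2) unfolding L_def mem_Collect_eq by metis
    then show "d \<in> (\<Union>b<w. L b) - {0\<^sub>v (2 * k)}"
      using \<open>i div n < w\<close> d zero_notin_D by auto
  qed
  show "(\<Union>b<w. L b) - {0\<^sub>v (2 * k)} \<subseteq> D"
  proof clarify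
    fix u b
    assume b: "b < w" and "u \<in> L b" and nz: "u \<notin> D"
    then obtain a j where u: "j < n" "u = a \<cdot>\<^sub>v col M (b * n + j)"
      unfolding L_def by blast
    then have "b * n + j < dim_col M"
      using block_index[OF b] M by simp
    then have "a = 0"
      using nz u unfolding scaled_columns_def by blast
    then show "u = 0\<^sub>v (2 * k)"
      using u M by (auto simp: vec_eq_iff)
  qed
qed

text \<open>The difference u - u' = v' - v lies in both blocks and hence vanishes.\<close>

lemma L_decomposition_unique:
  assumes "b < w" "b' < w" "b \<noteq> b'" and u: "u \<in> L b" "u' \<in> L b" and v: "v \<in> L b'" "v' \<in> L b'"
    and eq: "u + v = u' + v'"
  shows "u = u' \<and> v = v'"
proof -
  have carr: "u \<in> carrier_vec (2 * k)" "u' \<in> carrier_vec (2 * k)"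
    "v \<in> carrier_vec (2 * k)" "v' \<in> carrier_vec (2 * k)"
    using L_carrier assms by blast+
  have "u $ i + v $ i = u' $ i + v' $ i" if "i < 2 * k" for i
    using arg_cong[OF eq, of "\<lambda>s. s $ i"] carr that by simp
  then have "u + - u' = v' + - v"
    using carr by (intro eq_vecI) (auto simp: algebra_simps diff_eq_eq eq_diff_eq)
  moreover have "u + - u' \<in> L b" "v' + - v \<in> L b'"
    using assms L_uminus L_add by blast+
  ultimately have zero: "u + - u' = 0\<^sub>v (2 * k)" "v' + - v = 0\<^sub>v (2 * k)"
    using L_disjoint[OF assms(1,2,3)] by metis+
  show ?thesis
    using arg_cong[OF zero(1), of "\<lambda>s. s + u'"] arg_cong[OF zero(2), of "\<lambda>s. s + v"] carr
    by (auto simp: vec_eq_iff)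
qed

text \<open>Existence follows from uniqueness: q^k q^k distinct sums exhaust a space with q^2k
  elements.\<close>

lemma L_decomposition:
  assumes b: "b < w" "b' < w" "b \<noteq> b'" and s: "s \<in> carrier_vec (2 * k)"
  obtains u v where "u \<in> L b" "v \<in> L b'" "s = u + v"
proof -
  have "inj_on (\<lambda>(u, v). u + v) (L b \<times> L b')"
    using L_decomposition_unique[OF b] by (intro inj_onI) auto
  then have "card ((\<lambda>(u, v). u + v) ` (L b \<times> L b')) = card (carrier_vec (2 * k) :: 'a vec set)"
    using card_L b by (simp add: card_image card_cartesian_product card_carrier_vec
        flip: power_add mult_2)
  moreover have "(\<lambda>(u, v). u + v) ` (L b \<times> L b') \<subseteq> carrier_vec (2 * k)"
    using L_carrier b by auto
  ultimately have "(\<lambda>(u, v). u + v) ` (L b \<times> L b') = carrier_vec (2 * k)"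
    using card_subset_eq[OF finite_carrier_vec] by blast
  then show thesis
    using s that by force
qed

text \<open>Blocks 0 and 1 already reach every syndrome in at most two steps.\<close>

sublocale two_covering_check_matrix M "2 * k" "w * n"
proof
  fix s :: "'a vec"
  assume "s \<in> carrier_vec (2 * k)"
  then obtain u v where "u \<in> L 0" "v \<in> L 1" "s = u + v"
    using L_decomposition[of 0 1] w_ge_3 by auto
  then show "\<exists>u\<in>insert (0\<^sub>v (2 * k)) D. \<exists>v\<in>insert (0\<^sub>v (2 * k)) D. s = u + v"
    using w_ge_3 unfolding D_eq_UN_L by (intro bexI[of _ u] bexI[of _ v]) auto
qed

text \<open>The first column of block 2 is split along blocks 0 and 1. If one part were zero, this
  nonzero column would lie in two blocks; so three columns from different blocks are related with
  nonzero coefficients.\<close>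

lemma min_distance_spread: "min_distance (mat_kernel M) = 3"
proof -
  have "1 \<cdot>\<^sub>v col M (2 * n + 0) \<in> L 2"
    unfolding L_def using n_pos by blast
  then have s: "col M (2 * n) \<in> L 2"
    by simp
  have nz: "col M (2 * n) \<noteq> 0\<^sub>v (2 * k)"
    using independent_columns_nonzero[OF independent, of 1 "2 * n"] block_index[of 2 0] w_ge_3 n_pos M
    by simp
  obtain u v where uv: "u \<in> L 0" "v \<in> L 1" "col M (2 * n) = u + v"
    using L_decomposition[of 0 1, OF _ _ _ L_carrier[OF _ s]] w_ge_3 by auto
  then have carr: "u \<in> carrier_vec (2 * k)" "v \<in> carrier_vec (2 * k)"
    using L_carrier[of 0] L_carrier[of 1] w_ge_3 by auto
  have "u \<noteq> 0\<^sub>v (2 * k)"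
    using L_disjoint[of 1 2 v] uv s nz carr w_ge_3 by auto
  moreover have "v \<noteq> 0\<^sub>v (2 * k)"
    using L_disjoint[of 0 2 u] uv s nz carr w_ge_3 by auto
  moreover obtain a i b j where u: "i < n" "u = a \<cdot>\<^sub>v col M i" and v: "j < n" "v = b \<cdot>\<^sub>v col M (n + j)"
    using uv unfolding L_def by auto
  ultimately have ab: "a \<noteq> 0" "b \<noteq> 0"
    using M by (auto simp: vec_eq_iff)
  have lt: "i < w * n" "n + j < w * n" "2 * n < w * n"
    using block_index[of 0 i] block_index[of 1 j] block_index[of 2 0] u v w_ge_3 n_pos by auto
  show ?thesis
    using u v n_pos uv
    by (intro min_distance_eq_3[OF lt _ _ _ ab one_neq_zero]) auto
qed

text \<open>For \<open>s \<noteq> 0\<close> every ordered pair of distinct blocks avoiding \<open>s\<close> contributes exactly one step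
  \<open>d\<close>, namely the one with \<open>s = (- d) + (s + d)\<close> the decomposition of \<open>s\<close> along the two blocks.\<close>

lemma card_steps_off_block:
  assumes s: "s \<in> carrier_vec (2 * k)" "s \<noteq> 0\<^sub>v (2 * k)"
    and T: "T = {b. b < w \<and> s \<notin> L b}"
  shows "card {d \<in> D. s + d \<in> D \<and> (\<forall>b<w. s \<in> L b \<longrightarrow> d \<notin> L b)} = card T * (card T - 1)"
proof -
  have Tw: "b < w" "s \<notin> L b" if "b \<in> T" for b
    using that T by auto
  have fin: "finite T"
    unfolding T by simp
  have cancel: "s + d + - s = d" "s + d + - d = s" if "d \<in> carrier_vec (2 * k)" for d
    using that s(1) by (auto simp: vec_eq_iff)
  have off_d: "d \<noteq> 0\<^sub>v (2 * k)" if "s + d \<in> L b'" "b' \<in> T" for d b'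
    using that Tw s by auto
  \<comment> \<open>If s + d were 0, then s = - d would lie in the block of d, which avoids
    s.\<close>
  have off_sd: "s + d \<noteq> 0\<^sub>v (2 * k)" if "d \<in> L b" "b \<in> T" for d b
  proof
    assume "s + d = 0\<^sub>v (2 * k)"
    then have "s = 0\<^sub>v (2 * k) + - d"
      using cancel(2)[OF L_carrier[OF Tw(1)]] that by metis
    then show False
      using L_add[OF Tw(1) zero_in_L L_uminus] Tw that by metis
  qed
  have one: "card {d \<in> L b. s + d \<in> L b'} = 1" if b: "b \<in> T" "b' \<in> T - {b}" for b b'
  proof -
    have bw: "b < w" "b' < w" "b \<noteq> b'"
      using b Tw by auto
    obtain u v where uv: "u \<in> L b" "v \<in> L b'" "s = u + v"
      using L_decomposition[OF bw s(1)] .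
    then have carr: "u \<in> carrier_vec (2 * k)" "v \<in> carrier_vec (2 * k)"
      using bw L_carrier by blast+
    have "d = - u" if d: "d \<in> L b" "s + d \<in> L b'" for d
    proof -
      have dc: "d \<in> carrier_vec (2 * k)"
        using L_carrier bw d by blast
      have "- d + (s + d) = s"
        using dc s(1) by (auto simp: vec_eq_iff)
      then have "- d + (s + d) = u + v"
        unfolding uv(3) .
      then have "- d = u"
        using L_decomposition_unique[OF bw L_uminus[OF d(1)] uv(1) d(2) uv(2)] by blast
      then show "d = - u"
        by (metis uminus_uminus_vec)
    qed
    moreover have "s + - u = v"
      unfolding uv(3) using carr by (auto simp: vec_eq_iff)
    ultimately have "{d \<in> L b. s + d \<in> L b'} = {- u}"
      using uv L_uminus by auto
    then show ?thesis
      by simp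
  qed
  \<comment> \<open>The index pair consists of the block of d and the block of s + d. If d misses
    the block of s, then so does s + d, as d = (s + d) - s; and the two blocks differ, as s = (s +
    d) - d would otherwise lie in one that avoids it.\<close>
  have "{d \<in> D. s + d \<in> D \<and> (\<forall>b<w. s \<in> L b \<longrightarrow> d \<notin> L b)} =
      (\<Union>b\<in>T. \<Union>b'\<in>T - {b}. {d \<in> L b. s + d \<in> L b'})" (is "?X = ?U")
  proof
    show "?X \<subseteq> ?U"
    proof clarify
      fix d
      assume d: "d \<in> D" "s + d \<in> D" and off: "\<forall>b<w. s \<in> L b \<longrightarrow> d \<notin> L b"
      then obtain b b' where b: "b < w" "d \<in> L b" "b' < w" "s + d \<in> L b'"
        unfolding D_eq_UN_L by blast
      have dc: "d \<in> carrier_vec (2 * k)"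
        using D_carrier d by blast
      have "s \<notin> L b"
        using off b by blast
      moreover have "s \<notin> L b'"
      proof
        assume "s \<in> L b'"
        then have "d \<in> L b'"
          using L_add[OF b(3,4) L_uminus] cancel(1)[OF dc] by metis
        then show False
          using off b \<open>s \<in> L b'\<close> by blast
      qed
      moreover have "b \<noteq> b'"
        using L_add[OF b(3,4) L_uminus] cancel(2)[OF dc] b \<open>s \<notin> L b\<close> by metis
      ultimately show "d \<in> ?U"
        using b T by auto
    qed
    show "?U \<subseteq> ?X"
    proof clarify
      fix d b b'
      assume b: "b \<in> T" "b' \<in> T" "b' \<noteq> b" and d: "d \<in> L b" "s + d \<in> L b'"
      have nz: "d \<noteq> 0\<^sub>v (2 * k)" "s + d \<noteq> 0\<^sub>v (2 * k)"
        using off_d[OF d(2) b(2)] off_sd[OF d(1) b(1)] by auto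
      have "d \<notin> L e" if "e < w" "s \<in> L e" for e
        using L_disjoint[of b e d] d b nz that Tw by metis
      then show "d \<in> D \<and> s + d \<in> D \<and> (\<forall>b<w. s \<in> L b \<longrightarrow> d \<notin> L b)"
        using nz d b Tw unfolding D_eq_UN_L by blast
    qed
  qed
  moreover have "finite {d \<in> L b. s + d \<in> L b'}" if "b \<in> T" for b b'
    using L_carrier[OF Tw(1)[OF that]]
    by (intro finite_subset[OF _ finite_carrier_vec[of "2 * k"]]) auto
  moreover have "card (\<Union>b'\<in>T - {b}. {d \<in> L b. s + d \<in> L b'}) = card T - 1" if b: "b \<in> T" for b
  proof -
    have "card (\<Union>b'\<in>T - {b}. {d \<in> L b. s + d \<in> L b'}) =
        (\<Sum>b'\<in>T - {b}. card {d \<in> L b. s + d \<in> L b'})"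
    proof (rule card_UN_disjoint)
      show "finite (T - {b})" "\<forall>b'\<in>T - {b}. finite {d \<in> L b. s + d \<in> L b'}"
        using fin calculation(2)[OF b] by auto
      \<comment> \<open>The second block is recovered from the nonzero vector s + d.\<close>
      show "\<forall>i\<in>T - {b}. \<forall>j\<in>T - {b}. i \<noteq> j \<longrightarrow>
          {d \<in> L b. s + d \<in> L i} \<inter> {d \<in> L b. s + d \<in> L j} = {}"
        using L_disjoint Tw off_sd[OF _ b] by blast
    qed
    then show ?thesis
      using one b fin by simp
  qed
  moreover have "card (\<Union>b\<in>T. \<Union>b'\<in>T - {b}. {d \<in> L b. s + d \<in> L b'}) =
      (\<Sum>b\<in>T. card (\<Union>b'\<in>T - {b}. {d \<in> L b. s + d \<in> L b'}))"
  proof (rule card_UN_disjoint)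
    show "finite T" "\<forall>b\<in>T. finite (\<Union>b'\<in>T - {b}. {d \<in> L b. s + d \<in> L b'})"
      using fin calculation(2) by auto
    \<comment> \<open>The first block is recovered from the nonzero vector d.\<close>
    show "\<forall>i\<in>T. \<forall>j\<in>T. i \<noteq> j \<longrightarrow>
      (\<Union>b'\<in>T - {i}. {d \<in> L i. s + d \<in> L b'}) \<inter> (\<Union>b'\<in>T - {j}. {d \<in> L j. s + d \<in> L b'}) = {}"
      using L_disjoint Tw off_d by blast
  qed
  ultimately show ?thesis
    by simp
qed

lemma card_steps_2:
  assumes "s \<in> carrier_vec (2 * k) - insert (0\<^sub>v (2 * k)) D"
  shows "card {d \<in> D. s + d \<in> D} = w * (w - 1)"
proof -
  have s: "s \<in> carrier_vec (2 * k)" "s \<noteq> 0\<^sub>v (2 * k)" and off: "\<forall>b<w. s \<notin> L b"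
    using assms unfolding D_eq_UN_L by auto
  then have "{b. b < w \<and> s \<notin> L b} = {..<w}"
    by auto
  then show ?thesis
    using card_steps_off_block[OF s refl] off by simp
qed

text \<open>The w - 1 blocks avoiding s contribute the first term through their ordered pairs.
  Inside the block of s every d keeps s + d in the block, and only d = 0 and d = - s have to be left
  out.\<close>

lemma card_steps_1:
  assumes "s \<in> D"
  shows "card {d \<in> D. s + d \<in> D} = (w - 1) * (w - 2) + (CARD('a) ^ k - 2)"
proof -
  obtain b where b: "b < w" "s \<in> L b" and nz: "s \<noteq> 0\<^sub>v (2 * k)"
    using assms unfolding D_eq_UN_L by blast
  have s: "s \<in> carrier_vec (2 * k)"
    using D_carrier assms .
  have only: "s \<in> L e \<longleftrightarrow> e = b" if "e < w" for e
    using L_disjoint[OF b(1) that] b nz by auto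
  then have "{e. e < w \<and> s \<notin> L e} = {..<w} - {b}"
    using b by auto
  then have "card {e. e < w \<and> s \<notin> L e} = w - 1"
    using b by simp
  moreover have "(\<forall>e<w. s \<in> L e \<longrightarrow> d \<notin> L e) \<longleftrightarrow> d \<notin> L b" for d
    using only b by blast
  ultimately have off: "card {d \<in> D. s + d \<in> D \<and> d \<notin> L b} = (w - 1) * (w - 2)"
    using card_steps_off_block[OF s nz refl] by (simp add: numeral_2_eq_2)
  have "{d \<in> D. s + d \<in> D \<and> d \<in> L b} = L b - {0\<^sub>v (2 * k), - s}"
  proof -
    have "s + d = 0\<^sub>v (2 * k) \<longleftrightarrow> d = - s" if "d \<in> L b" for d
      using L_carrier[OF b(1) that] s by (auto simp: vec_eq_iff eq_neg_iff_add_eq_0 add.commute)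
    then show ?thesis
      using L_add[OF b] b(1) unfolding D_eq_UN_L by auto
  qed
  \<comment> \<open>The two removed vectors 0 and - s are different, so exactly 2 is
    subtracted.\<close>
  moreover have "- s \<noteq> 0\<^sub>v (2 * k)"
    using uminus_scaled_columns[OF assms] zero_notin_D by metis
  ultimately have on: "card {d \<in> D. s + d \<in> D \<and> d \<in> L b} = CARD('a) ^ k - 2"
    using zero_in_L[OF b(1)] L_uminus[OF b(2)] card_L[OF b(1)]
    by (simp add: card_Diff_subset)
  have "{d \<in> D. s + d \<in> D} = {d \<in> D. s + d \<in> D \<and> d \<notin> L b} \<union> {d \<in> D. s + d \<in> D \<and> d \<in> L b}"
    by blast
  then have "card {d \<in> D. s + d \<in> D} =
      card {d \<in> D. s + d \<in> D \<and> d \<notin> L b} + card {d \<in> D. s + d \<in> D \<and> d \<in> L b}"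
    using finite_D by (subst card_Un_disjoint[symmetric]) auto
  then show ?thesis
    unfolding off on .
qed

end

section \<open>Cyclic shifts of a Hamming check matrix\<close>

lemma bij_betw_pred_mod: "bij_betw (\<lambda>j. (j + n - 1) mod n) {..<n} {..<n::nat}"
proof -
  have "Suc ((j + n - 1) mod n) mod n = j" if "j < n" for j
    using that by (simp add: mod_Suc_eq)
  then have "inj_on (\<lambda>j. (j + n - 1) mod n) {..<n}"
    by (intro inj_onI) (metis lessThan_iff)
  moreover have "(\<lambda>j. (j + n - 1) mod n) ` {..<n} \<subseteq> {..<n}"
    by auto
  ultimately show ?thesis
    unfolding bij_betw_def using endo_inj_surj by blast
qed

lemma shift_cols_carrier: "A \<in> carrier_mat k n \<Longrightarrow> shift_cols A \<in> carrier_mat k n"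
  unfolding shift_cols_def by auto

lemma funpow_shift_cols_carrier: "A \<in> carrier_mat k n \<Longrightarrow> (shift_cols ^^ i) A \<in> carrier_mat k n"
  by (induction i) (auto intro: shift_cols_carrier)

text \<open>Adding \<open>i * (n - 1)\<close> is subtracting i modulo n, in a form that avoids
  truncated subtraction.\<close>

lemma col_funpow_shift_cols:
  assumes A: "A \<in> carrier_mat k n" and "j < n"
  shows "col ((shift_cols ^^ i) A) j = col A ((j + i * (n - 1)) mod n)"
  using assms(2)
proof (induction i arbitrary: j)
  case (Suc i)
  have B: "(shift_cols ^^ i) A \<in> carrier_mat k n"
    using funpow_shift_cols_carrier[OF A] .
  have "col ((shift_cols ^^ Suc i) A) j = col ((shift_cols ^^ i) A) ((j + n - 1) mod n)"
    using Suc.prems B by (intro eq_vecI) (auto simp: shift_cols_def)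
  also have "\<dots> = col A (((j + n - 1) mod n + i * (n - 1)) mod n)"
    using Suc by simp
  also have "((j + n - 1) mod n + i * (n - 1)) mod n = (j + Suc i * (n - 1)) mod n"
    using Suc.prems by (simp add: mod_add_left_eq) (metis add.assoc)
  finally show ?case .
qed simp

text \<open>Shifting the columns and the coordinates together only permutes the summands of each
  scalar product.\<close>

lemma mult_shift_cols_cyclic_shift:
  fixes A :: "'a::comm_ring_1 mat"
  assumes A: "A \<in> carrier_mat k n" and x: "x \<in> carrier_vec n"
  shows "shift_cols A *\<^sub>v cyclic_shift x = A *\<^sub>v x"
proof (rule eq_vecI)
  fix r
  assume "r < dim_vec (A *\<^sub>v x)"
  then have r: "r < k"
    using A by simp
  have "(shift_cols A *\<^sub>v cyclic_shift x) $ r =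
      (\<Sum>j\<in>{..<n}. A $$ (r, (j + n - 1) mod n) * x $ ((j + n - 1) mod n))"
    using A x r by (auto simp: shift_cols_def cyclic_shift_def scalar_prod_def lessThan_atLeast0)
  also have "\<dots> = (\<Sum>j\<in>{..<n}. A $$ (r, j) * x $ j)"
    by (rule sum.reindex_bij_betw[OF bij_betw_pred_mod, of "\<lambda>j. A $$ (r, j) * x $ j"])
  also have "\<dots> = (A *\<^sub>v x) $ r"
    using A x r by (auto simp: scalar_prod_def lessThan_atLeast0)
  finally show "(shift_cols A *\<^sub>v cyclic_shift x) $ r = (A *\<^sub>v x) $ r" .
qed (use A in \<open>auto simp: shift_cols_def\<close>)

lemma inj_on_cyclic_shift: "inj_on cyclic_shift (carrier_vec n)"
proof (rule inj_onI)
  fix x y :: "'a vec"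
  assume x: "x \<in> carrier_vec n" and y: "y \<in> carrier_vec n" and eq: "cyclic_shift x = cyclic_shift y"
  show "x = y"
  proof (rule eq_vecI)
    fix i
    assume "i < dim_vec y"
    then have "i \<in> (\<lambda>j. (j + n - 1) mod n) ` {..<n}"
      using bij_betw_pred_mod[of n] y unfolding bij_betw_def by auto
    then obtain j where "j < n" "i = (j + n - 1) mod n"
      by blast
    then show "x $ i = y $ i"
      using arg_cong[OF eq, of "\<lambda>z. z $ j"] x y by (simp add: cyclic_shift_def)
  qed (use x y in auto)
qed

text \<open>Each kernel word x is the shift of another kernel word y, and the next shifted matrix
  maps x to what the previous one maps y to, namely 0.\<close>

lemma cyclic_kernel_subset_funpow_shift_cols:
  fixes H :: "'a::{field,finite} mat"
  assumes H: "H \<in> carrier_mat k n" and cyc: "cyclic_code (mat_kernel H)"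
  shows "mat_kernel H \<subseteq> mat_kernel ((shift_cols ^^ i) H)"
proof (induction i)
  case (Suc i)
  have B: "(shift_cols ^^ i) H \<in> carrier_mat k n"
    using funpow_shift_cols_carrier[OF H] .
  \<comment> \<open>\<open>cyclic_code\<close> gives only one inclusion; injectivity on a finite set
    gives the other.\<close>
  have "cyclic_shift ` mat_kernel H = mat_kernel H"
    using cyc inj_on_subset[OF inj_on_cyclic_shift mat_kernel_carrier[OF H]]
    by (intro endo_inj_surj finite_mat_kernel[OF H]) (auto simp: cyclic_code_def)
  moreover have "cyclic_shift y \<in> mat_kernel ((shift_cols ^^ Suc i) H)" if "y \<in> mat_kernel H" for y
  proof -
    have y: "y \<in> carrier_vec n" "(shift_cols ^^ i) H *\<^sub>v y = 0\<^sub>v k"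
      using mat_kernelD[OF B] Suc that by auto
    then show ?thesis
      using mult_shift_cols_cyclic_shift[OF B y(1)] shift_cols_carrier[OF B]
      by (intro mat_kernelI[of _ k n]) (auto simp: cyclic_shift_def)
  qed
  ultimately show ?case
    by (metis image_iff subsetI)
qed simp

text \<open>The sum of two multiples of columns of \<open>H\<close> is again such a multiple. That
  relation is a word of the kernel of \<open>H\<close>, hence of the kernel of \<open>G\<close>, and
  so holds between the corresponding columns of \<open>G\<close>.\<close>

lemma scaled_columns_add_closed:
  fixes H G :: "'a::field mat"
  assumes H: "H \<in> carrier_mat k n" and G: "G \<in> carrier_mat m n" and "0 < n"
    and all: "scaled_columns H = carrier_vec k - {0\<^sub>v k}" and ker: "mat_kernel H \<subseteq> mat_kernel G"
    and u: "u \<in> {a \<cdot>\<^sub>v col G j | a j. j < n}" and v: "v \<in> {a \<cdot>\<^sub>v col G j | a j. j < n}"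
  shows "u + v \<in> {a \<cdot>\<^sub>v col G j | a j. j < n}"
proof -
  obtain a i b j where ij: "i < n" "j < n" "u = a \<cdot>\<^sub>v col G i" "v = b \<cdot>\<^sub>v col G j"
    using u v by blast
  have carr: "a \<cdot>\<^sub>v col H i + b \<cdot>\<^sub>v col H j \<in> carrier_vec k"
    using H by auto
  obtain d l where l: "l < n" "a \<cdot>\<^sub>v col H i + b \<cdot>\<^sub>v col H j = d \<cdot>\<^sub>v col H l"
  proof (cases "a \<cdot>\<^sub>v col H i + b \<cdot>\<^sub>v col H j = 0\<^sub>v k")
    case True
    \<comment> \<open>A zero sum is no nonzero multiple of a column; column 0 with coefficient 0
      serves instead.\<close>
    moreover have "0 \<cdot>\<^sub>v col H 0 = 0\<^sub>v k"
      using H by (auto simp: vec_eq_iff)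
    ultimately show thesis
      using that[OF \<open>0 < n\<close>] by metis
  next
    case False
    then have "a \<cdot>\<^sub>v col H i + b \<cdot>\<^sub>v col H j \<in> scaled_columns H"
      using carr unfolding all by blast
    then show thesis
      using that H unfolding scaled_columns_def by auto
  qed
  define x where "x = a \<cdot>\<^sub>v unit_vec n i + b \<cdot>\<^sub>v unit_vec n j - d \<cdot>\<^sub>v unit_vec n l"
  have mult: "F *\<^sub>v x = a \<cdot>\<^sub>v col F i + b \<cdot>\<^sub>v col F j - d \<cdot>\<^sub>v col F l"
    if "F \<in> carrier_mat p n" for F :: "'a mat" and p
    unfolding x_def using ij l
    by (simp add: mult_minus_distrib_mat_vec[OF that] mult_add_distrib_mat_vec[OF that]
        mult_mat_smult_unit_vec[OF that])
  have "H *\<^sub>v x = 0\<^sub>v k"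
    unfolding mult[OF H] l(2) using H by (auto simp: vec_eq_iff)
  then have "x \<in> mat_kernel H"
    by (intro mat_kernelI[OF H]) (auto simp: x_def)
  then have "a \<cdot>\<^sub>v col G i + b \<cdot>\<^sub>v col G j - d \<cdot>\<^sub>v col G l = 0\<^sub>v m"
    using ker mat_kernelD(2)[OF G] mult[OF G] by auto
  then have "u + v = d \<cdot>\<^sub>v col G l"
    unfolding ij using G by (auto simp: vec_eq_iff)
  then show ?thesis
    using l by blast
qed

section \<open>Block columns of the extended check matrix\<close>

definition top_block :: "'a::zero mat \<Rightarrow> nat \<Rightarrow> 'a mat" where
  "top_block H b = (if b = 1 then 0\<^sub>m (dim_row H) (dim_col H) else H)"

text \<open>Truncated subtraction makes block column 1 an unshifted copy of \<open>H\<close>, like block column 2.\<close>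

definition bottom_block :: "'a::zero mat \<Rightarrow> nat \<Rightarrow> 'a mat" where
  "bottom_block H b = (if b = 0 then 0\<^sub>m (dim_row H) (dim_col H) else (shift_cols ^^ (b - 2)) H)"

lemma top_block_carrier: "H \<in> carrier_mat k n \<Longrightarrow> top_block H b \<in> carrier_mat k n"
  unfolding top_block_def by auto

lemma bottom_block_carrier: "H \<in> carrier_mat k n \<Longrightarrow> bottom_block H b \<in> carrier_mat k n"
  unfolding bottom_block_def by (auto intro: funpow_shift_cols_carrier)

lemma extended_check_matrix_carrier:
  "H \<in> carrier_mat k n \<Longrightarrow> extended_check_matrix H c \<in> carrier_mat (2 * k) ((c + 3) * n)"
  unfolding extended_check_matrix_def Let_def by auto

lemma col_extended_check_matrix:
  assumes H: "H \<in> carrier_mat k n" and b: "b < c + 3" and j: "j < n"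
  shows "col (extended_check_matrix H c) (b * n + j) = col (top_block H b @\<^sub>r bottom_block H b) j"
proof -
  have "b * n + j < (c + 3) * n"
    using b j by (metis add_less_cancel_left add.commute less_le_trans mult_Suc mult_le_mono1 Suc_leI)
  moreover have "([H, 0\<^sub>m k n, H] @ replicate c H) ! b = top_block H b"
    using b H unfolding top_block_def
    by (auto simp: nth_append nth_Cons' numeral_2_eq_2 numeral_3_eq_3)
  moreover have "([0\<^sub>m k n, H, H] @ map (\<lambda>i. (shift_cols ^^ i) H) [1..<c + 1]) ! b = bottom_block H b"
  proof (cases "b < 3")
    case True
    then have "b = 0 \<or> b = 1 \<or> b = 2"
      by linarith
    then show ?thesis
      using H unfolding bottom_block_def by auto
  next
    case False
    then have "([0\<^sub>m k n, H, H] @ Bs) ! b = Bs ! (b - 3)" for Bs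
      by (simp add: nth_append numeral_3_eq_3)
    then have "([0\<^sub>m k n, H, H] @ map (\<lambda>i. (shift_cols ^^ i) H) [1..<c + 1]) ! b =
        map (\<lambda>i. (shift_cols ^^ i) H) [1..<c + 1] ! (b - 3)" .
    \<comment> \<open>The shift list starts with 1 at block 3, so block b carries the shift b - 2;
      this also fits block 2, which is unshifted.\<close>
    also have "\<dots> = (shift_cols ^^ (1 + (b - 3))) H"
      using b False nth_upt[of 1 "b - 3" "c + 1"] by (subst nth_map) (simp_all del: upt_Suc)
    also have "1 + (b - 3) = b - 2"
      using False by simp
    finally show ?thesis
      using False unfolding bottom_block_def by simp
  qed
  ultimately show ?thesis
    using H j top_block_carrier[OF H, of b] bottom_block_carrier[OF H, of b]
    unfolding extended_check_matrix_def Let_def append_rows_def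
    by (intro eq_vecI) auto
qed

lemma mat_kernel_append_rows:
  assumes "A \<in> carrier_mat k n" "B \<in> carrier_mat l n"
  shows "mat_kernel A \<inter> mat_kernel B \<subseteq> mat_kernel (A @\<^sub>r B)"
proof clarify
  fix x
  assume "x \<in> mat_kernel A" "x \<in> mat_kernel B"
  then have "x \<in> carrier_vec n" "A *\<^sub>v x = 0\<^sub>v k" "B *\<^sub>v x = 0\<^sub>v l"
    using mat_kernelD[OF assms(1)] mat_kernelD[OF assms(2)] by blast+
  then show "x \<in> mat_kernel (A @\<^sub>r B)"
    using mat_mult_append[OF assms] by (intro mat_kernelI[OF carrier_append_rows[OF assms]]) auto
qed

text \<open>A zero half is killed by every word, an unshifted half has the kernel of
  \<open>H\<close>, and for a shifted half cyclicity is used.\<close>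

lemma kernel_subset_kernel_blocks:
  fixes H :: "'a::{field,finite} mat"
  assumes H: "H \<in> carrier_mat k n" and cyc: "cyclic_code (mat_kernel H)"
  shows "mat_kernel H \<subseteq> mat_kernel (top_block H b @\<^sub>r bottom_block H b)"
proof -
  have "0\<^sub>m k n *\<^sub>v x = 0\<^sub>v k" if "x \<in> carrier_vec n" for x :: "'a vec"
    using that by (intro eq_vecI) auto
  then have "mat_kernel H \<subseteq> mat_kernel (0\<^sub>m k n)"
    using mat_kernel_carrier[OF H] by (auto intro!: mat_kernelI[of _ k n])
  then have "mat_kernel H \<subseteq> mat_kernel (top_block H b)" "mat_kernel H \<subseteq> mat_kernel (bottom_block H b)"
    using cyclic_kernel_subset_funpow_shift_cols[OF H cyc] H
    unfolding top_block_def bottom_block_def by auto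
  then show ?thesis
    using mat_kernel_append_rows[OF top_block_carrier[OF H] bottom_block_carrier[OF H]] by blast
qed

lemma smult_append_vec: "a \<cdot>\<^sub>v (u @\<^sub>v v) = (a \<cdot>\<^sub>v u) @\<^sub>v (a \<cdot>\<^sub>v v)"
  by (intro eq_vecI) auto

lemma col_append_rows:
  assumes "A \<in> carrier_mat k n" "B \<in> carrier_mat l n" "j < n"
  shows "col (A @\<^sub>r B) j = col A j @\<^sub>v col B j"
  using assms unfolding append_rows_def by (intro eq_vecI) auto

lemma shift_index_inj:
  fixes n :: nat
  assumes "(j + i * (n - 1)) mod n = (j + i' * (n - 1)) mod n" "i < n" "i' < n"
  shows "i = i'"
proof -
  have red: "(j + t * (n - 1) + t) mod n = j mod n" if "t < n" for t
  proof -
    have "j + t * (n - 1) + t = j + t * n"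
      using that by (cases n) auto
    then show ?thesis
      by (simp only: mod_mult_self1)
  qed
  \<comment> \<open>As \<open>n - 1\<close> acts as -1, adding i + i' to both sides cancels the
    shifts and leaves j + i' against j + i.\<close>
  have "(j + i * (n - 1) + i + i') mod n = (j + i' * (n - 1) + i' + i) mod n"
    using mod_add_cong[OF assms(1) refl, of "i + i'"] by (simp only: ac_simps)
  then have "(j + i') mod n = (j + i) mod n"
    using mod_add_cong[OF red[OF assms(2)] refl, of i'] mod_add_cong[OF red[OF assms(3)] refl, of i]
    by (simp only:)
  then obtain r r' where "j + i' + n * r = j + i + n * r'"
    using nat_mod_eq_iff by blast
  then have "(i' + n * r) mod n = (i + n * r') mod n"
    by simp
  then show ?thesis
    using assms(2,3) by simp
qed

text \<open>The zero halves single out blocks 0 and 1. In the other blocks the upper half determines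
  the column number and the scalar, and the lower half then determines the shift.\<close>

lemma independent_columns_extended:
  fixes H :: "'a::{field,finite} mat"
  assumes H: "H \<in> carrier_mat k n" and ind: "independent_columns H" and n: "0 < n" and c: "c \<le> n - 1"
  shows "independent_columns (extended_check_matrix H c)"
  unfolding independent_columns_def
proof (intro allI impI)
  fix i i' a a'
  assume i: "i < dim_col (extended_check_matrix H c)" "i' < dim_col (extended_check_matrix H c)"
    and a: "a \<noteq> 0"
    and eq: "a \<cdot>\<^sub>v col (extended_check_matrix H c) i = a' \<cdot>\<^sub>v col (extended_check_matrix H c) i'"
  define b j b' j' where bj: "b = i div n" "j = i mod n" "b' = i' div n" "j' = i' mod n"
  have i_eq: "i = b * n + j" "i' = b' * n + j'" and j: "j < n" "j' < n"
    using n by (auto simp: bj)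
  have b: "b < c + 3" "b' < c + 3"
    using i extended_check_matrix_carrier[OF H, of c] by (auto simp: bj less_mult_imp_div_less)
  have "(a \<cdot>\<^sub>v col (top_block H b) j) @\<^sub>v (a \<cdot>\<^sub>v col (bottom_block H b) j) =
      (a' \<cdot>\<^sub>v col (top_block H b') j') @\<^sub>v (a' \<cdot>\<^sub>v col (bottom_block H b') j')"
    using eq b j unfolding i_eq
    by (simp add: col_extended_check_matrix[OF H] smult_append_vec
        col_append_rows[OF top_block_carrier[OF H] bottom_block_carrier[OF H]])
  moreover have "col (top_block H e) l \<in> carrier_vec k" for e l
    using top_block_carrier[OF H, of e] by (metis carrier_matD(1) col_dim)
  ultimately have top: "a \<cdot>\<^sub>v col (top_block H b) j = a' \<cdot>\<^sub>v col (top_block H b') j'"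
    and bot: "a \<cdot>\<^sub>v col (bottom_block H b) j = a' \<cdot>\<^sub>v col (bottom_block H b') j'"
    using append_vec_eq[of "a \<cdot>\<^sub>v col (top_block H b) j" k "a' \<cdot>\<^sub>v col (top_block H b') j'"]
    by auto
  define \<sigma> where "\<sigma> b j = (j + (b - 2) * (n - 1)) mod n" for b j
  have \<sigma>: "\<sigma> b j < n" for b j
    unfolding \<sigma>_def using n by simp
  have colt: "col (top_block H e) l = (if e = 1 then 0\<^sub>v k else col H l)" if "l < n" for e l
    using H that unfolding top_block_def by auto
  have colb: "col (bottom_block H e) l = (if e = 0 then 0\<^sub>v k else col H (\<sigma> e l))" if "l < n" for e l
    using H that col_funpow_shift_cols[OF H that] unfolding bottom_block_def \<sigma>_def by auto
  have nz: "d \<cdot>\<^sub>v col H l = 0\<^sub>v k \<longleftrightarrow> d = 0" if "l < n" for d l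
    using independent_columns_nonzero[OF ind, of d l] that H by (auto simp: vec_eq_iff)
  have z: "d \<cdot>\<^sub>v 0\<^sub>v k = 0\<^sub>v k" for d :: 'a
    by auto
  have D: "l = l'" "d = d'" if "d \<cdot>\<^sub>v col H l = d' \<cdot>\<^sub>v col H l'" "d \<noteq> 0" "l < n" "l' < n" for d d' l l'
    using independent_columnsD[OF ind] that H by auto
  have top': "(if b = 1 then 0\<^sub>v k else a \<cdot>\<^sub>v col H j) = (if b' = 1 then 0\<^sub>v k else a' \<cdot>\<^sub>v col H j')"
    using top j by (simp add: colt z split: if_splits)
  have bot': "(if b = 0 then 0\<^sub>v k else a \<cdot>\<^sub>v col H (\<sigma> b j)) =
      (if b' = 0 then 0\<^sub>v k else a' \<cdot>\<^sub>v col H (\<sigma> b' j'))"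
    using bot j by (simp add: colb z split: if_splits)
  \<comment> \<open>If \<open>a'\<close> were 0, both halves of the left column would vanish,
    placing it in block 1 and in block 0 at once.\<close>
  have a': "a' \<noteq> 0"
  proof
    assume "a' = 0"
    then have "a' \<cdot>\<^sub>v col H j' = 0\<^sub>v k" "a' \<cdot>\<^sub>v col H (\<sigma> b' j') = 0\<^sub>v k"
      using nz j \<sigma> by blast+
    then have "b = 1" "b = 0"
      using top' bot' nz[OF j(1), of a] nz[OF \<sigma>[of b j], of a] a by metis+
    then show False
      by simp
  qed
  have "b = 1 \<longleftrightarrow> b' = 1"
    using top' nz[OF j(1), of a] nz[OF j(2), of a'] a a' by metis
  moreover have "b = 0 \<longleftrightarrow> b' = 0"
    using bot' nz[OF \<sigma>[of b j], of a] nz[OF \<sigma>[of b' j'], of a'] a a' by metis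
  ultimately consider "b = 0" "b' = 0" | "b = 1" "b' = 1" | "2 \<le> b" "2 \<le> b'"
    by linarith
  then have "b = b' \<and> j = j' \<and> a = a'"
  proof cases
    case 1
    then show ?thesis
      using top' D[OF _ a j] by simp
  next
    case 2
    \<comment> \<open>Truncation gives 1 - 2 = 0, so \<open>\<sigma> 1 j = j\<close>.\<close>
    then have "a \<cdot>\<^sub>v col H j = a' \<cdot>\<^sub>v col H j'"
      using bot' j by (simp add: \<sigma>_def)
    then show ?thesis
      using 2 D[OF _ a j] by simp
  next
    case 3
    then have "a \<cdot>\<^sub>v col H j = a' \<cdot>\<^sub>v col H j'"
      using top' by simp
    note jj = D[OF this a j]
    have "\<sigma> b j = \<sigma> b' j'"
      using bot' 3 D(1)[OF _ a \<sigma> \<sigma>] by simp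
    then have "(j + (b - 2) * (n - 1)) mod n = (j + (b' - 2) * (n - 1)) mod n"
      using jj(1) unfolding \<sigma>_def by simp
    \<comment> \<open>Here c <= n - 1 enters: the shifts 0, ..., c are pairwise different modulo
      n.\<close>
    moreover have "b - 2 < n" "b' - 2 < n"
      using b c n by linarith+
    ultimately have "b - 2 = b' - 2"
      by (rule shift_index_inj)
    then show ?thesis
      using 3 jj by simp
  qed
  then show "i = i' \<and> a = a'"
    unfolding i_eq by simp
qed

lemma geometric_quotient:
  fixes q :: nat
  assumes "2 \<le> q" "n = (q ^ k - 1) div (q - 1)"
  shows "(q - 1) * n = q ^ k - 1"
proof -
  have "\<exists>t. q ^ k = (q - 1) * t + 1"
  proof (induction k)
    case (Suc k)
    then obtain t where t: "q ^ k = (q - 1) * t + 1"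
      by blast
    obtain p where "q = Suc p"
      using assms(1) by (cases q) auto
    then have "q ^ Suc k = (q - 1) * (q * t + 1) + 1"
      using t by (simp add: algebra_simps)
    then show ?case
      by blast
  qed auto
  then obtain t where "q ^ k = (q - 1) * t + 1"
    by blast
  then show ?thesis
    using assms by simp
qed

text \<open>Here N = q^k - 1, so (c + 3)N is the size of \<open>D\<close> and N + 1 - 2 is q^k - 2.
  The assumption keeps N - 1 - c from being truncated.\<close>

lemma intersection_number_b1:
  fixes N c :: nat
  assumes "c + 1 \<le> N"
  shows "(c + 3) * N - 1 - ((c + 3 - 1) * (c + 3 - 2) + (N + 1 - 2)) = (c + 2) * (N - 1 - c)"
proof -
  obtain e where "N = c + 1 + e"
    using assms le_Suc_ex by blast
  then show ?thesis
    by (simp add: algebra_simps)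
qed

theorem corollary3:
  fixes H :: "'a::{field,finite} mat"
    and C :: "'a vec set"
    and q k n c :: nat
  assumes "q = CARD('a)"
    and "k \<ge> 1"
    and "n = (q ^ k - 1) div (q - 1)"
    and "H \<in> carrier_mat k n"
    and "hamming_code n (mat_kernel H)"
    and "cyclic_code (mat_kernel H)"
    and "gcd n (q - 1) = 1"
    and "1 \<le> c" and "c \<le> n - 1"
    and "C = mat_kernel (extended_check_matrix H c)"
  shows "(q = 2 \<and> c = n - 1 \<longrightarrow> hamming_code (2 ^ (2 * k) - 1) C) \<and>
         (q > 2 \<or> c < n - 1 \<longrightarrow>
           code_params ((c + 3) * n) ((c + 3) * n - 2 * k) 3 2 C \<and>
           completely_regular ((c + 3) * n) C \<and>
           has_intersection_array ((c + 3) * n) C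
             [(c + 3) * n * (q - 1), (c + 2) * ((q - 1) * n - 1 - c)]
             [1, (c + 2) * (c + 3)])"
proof -
  note H = assms(4) and c = assms(9)
  have q: "2 \<le> q"
    using card_field_ge_2[where ?'a = 'a] assms(1) by simp
  have Nq: "(q - 1) * n = q ^ k - 1"
    using geometric_quotient[OF q assms(3)] .
  have n: "0 < n"
    using assms(8,9) by simp
  have cN: "c + 1 \<le> n" "n \<le> (q - 1) * n"
    using c n q by auto
  have qk: "q ^ k = (q - 1) * n + 1"
    using Nq q by simp
  obtain k' P where P: "hamming_check_matrix k' n P" "mat_kernel H = mat_kernel P"
    using assms(5) unfolding hamming_code_def by blast
  have "P \<in> carrier_mat k' n"
    using P(1) unfolding hamming_check_matrix_def by blast
  then have ind: "independent_columns H"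
    using independent_columns_kernel_eq[OF _ H P(2)[symmetric]]
      hamming_check_matrix_independent_columns[OF P(1)] by blast
  have all: "scaled_columns H = carrier_vec k - {0\<^sub>v k}"
    using scaled_columns_eq_nonzero_vectors[OF H ind] Nq assms(1) by simp
  define M where "M = extended_check_matrix H c"
  have M: "M \<in> carrier_mat (2 * k) ((c + 3) * n)"
    unfolding M_def using extended_check_matrix_carrier[OF H] .
  have indM: "independent_columns M"
    unfolding M_def using independent_columns_extended[OF H ind n c] .
  interpret spread_check_matrix M k n "c + 3"
  proof
    fix b u v
    assume b: "b < c + 3"
    have eq: "{a \<cdot>\<^sub>v col M (b * n + j) | a j. j < n} =
        {a \<cdot>\<^sub>v col (top_block H b @\<^sub>r bottom_block H b) j | a j. j < n}"
      unfolding M_def by (simp add: col_extended_check_matrix[OF H b] cong: rev_conj_cong)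
    assume u: "u \<in> {a \<cdot>\<^sub>v col M (b * n + j) | a j. j < n}"
      and v: "v \<in> {a \<cdot>\<^sub>v col M (b * n + j) | a j. j < n}"
    show "u + v \<in> {a \<cdot>\<^sub>v col M (b * n + j) | a j. j < n}"
      unfolding eq
      by (rule scaled_columns_add_closed[OF H
            carrier_append_rows[OF top_block_carrier[OF H] bottom_block_carrier[OF H]] n all
            kernel_subset_kernel_blocks[OF H assms(6)] u[unfolded eq] v[unfolded eq]])
  qed (use M indM n qk assms(1) in auto)
  have CM: "C = mat_kernel M"
    using assms(10) unfolding M_def .
  have cardD: "card D = (c + 3) * ((q - 1) * n)"
    using card_scaled_columns[OF indM] M assms(1) by (simp add: algebra_simps)
  show ?thesis
  proof (intro conjI impI)
    assume "q = 2 \<and> c = n - 1"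
    then have q2: "CARD('a) = 2" and "n + 1 = 2 ^ k" and c3: "c + 3 = n + 2"
      using qk n assms(1) by auto
    \<comment> \<open>Now (c + 3)n = (n + 2)n = (n + 1)^2 - 1, so the columns are numerous enough to
      meet every point of the doubled space.\<close>
    have "(n + 1) * (n + 1) = 2 ^ (2 * k)"
      unfolding \<open>n + 1 = 2 ^ k\<close> by (simp flip: power_add mult_2)
    then have N: "(c + 3) * n = 2 ^ (2 * k) - 1"
      unfolding c3 by (simp add: algebra_simps)
    then have "scaled_columns M = carrier_vec (2 * k) - {0\<^sub>v (2 * k)}"
      using q2 by (intro scaled_columns_eq_nonzero_vectors[OF M indM]) simp
    then have "hamming_check_matrix (2 * k) (2 ^ (2 * k) - 1) M"
      using hamming_check_matrixI[OF M indM] N by simp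
    then show "hamming_code (2 ^ (2 * k) - 1) C"
      unfolding hamming_code_def CM using q2 assms(2) by (intro exI[of _ "2 * k"] exI[of _ M]) simp
  next
    assume "q > 2 \<or> c < n - 1"
    then have "c + 1 < (q - 1) * n"
    proof
      assume "q > 2"
      then have "2 * n \<le> (q - 1) * n"
        by (intro mult_le_mono1) simp
      then show ?thesis
        using cN n by linarith
    qed (use cN in linarith)
    \<comment> \<open>With N = (q - 1)n the space has (N + 1)^2 - 1 = (N + 2)N nonzero vectors,
      while \<open>D\<close> has (c + 3)N; so c + 1 < N leaves a syndrome at distance 2.\<close>
    then have "(c + 3) * ((q - 1) * n) < ((q - 1) * n + 2) * ((q - 1) * n)"
      using q n by (intro mult_less_mono1) simp_all
    also have "((q - 1) * n + 2) * ((q - 1) * n) + 1 = q ^ (2 * k)"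
      unfolding mult_2 power_add qk by (simp add: algebra_simps)
    finally have "card D + 1 < q ^ (2 * k)"
      unfolding cardD by linarith
    then have "card (insert (0\<^sub>v (2 * k)) D) < card (carrier_vec (2 * k) :: 'a vec set)"
      using zero_notin_D finite_D assms(1) by (simp add: card_carrier_vec)
    then have proper: "insert (0\<^sub>v (2 * k)) D \<noteq> carrier_vec (2 * k)"
      by (metis nat_neq_iff)
    have radius: "covering_radius ((c + 3) * n) C = 2"
      unfolding CM by (rule covering_radius_eq_2[OF proper])
    show "code_params ((c + 3) * n) ((c + 3) * n - 2 * k) 3 2 C"
      unfolding code_params_def radius
      using subspace_kernel subspace_dim_kernel min_distance_spread
      by (simp add: linear_code_def CM)
    have numbers_D: "intersection_numbers ((c + 3) * n) C
        ((\<lambda>_. 0)(0 := card D, 1 := card D - 1 - ((c + 3 - 1) * (c + 3 - 2) + (CARD('a) ^ k - 2))))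
        ((\<lambda>_. 0)(1 := 1, 2 := (c + 3) * (c + 3 - 1)))"
      unfolding CM using intersection_numbers_syndrome[OF proper card_steps_1 card_steps_2] .
    have b0: "card D = (c + 3) * n * (q - 1)"
      unfolding cardD by (simp only: ac_simps)
    have "c + 1 \<le> (q - 1) * n"
      using cN by (rule order_trans)
    then have b1: "card D - 1 - ((c + 3 - 1) * (c + 3 - 2) + (CARD('a) ^ k - 2)) =
        (c + 2) * ((q - 1) * n - 1 - c)"
      unfolding cardD assms(1)[symmetric] qk by (rule intersection_number_b1)
    have c2: "(c + 3) * (c + 3 - 1) = (c + 2) * (c + 3)"
      by simp
    note numbers = numbers_D[unfolded b1, unfolded b0 c2]
    show "completely_regular ((c + 3) * n) C"
      unfolding completely_regular_def using numbers by blast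
    have upts: "[0..<2] = [0, 1]" "[1..<2 + 1] = [1, 2]"
      by (simp_all add: numeral_2_eq_2)
    show "has_intersection_array ((c + 3) * n) C
        [(c + 3) * n * (q - 1), (c + 2) * ((q - 1) * n - 1 - c)] [1, (c + 2) * (c + 3)]"
      unfolding has_intersection_array_def radius upts
      by (intro exI conjI, rule numbers) simp_all
  qed
qed

end
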